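(* Put $q=t^2$. The standard Bruhat polynomials of the homogeneous spaces listed are $$\begin{aligned} F(t)&=(1+q)(1+q+q^2)(1+q+q^2+q^3)&&\text{for }SO(6)/T^3, \\ E(t)&=(1+q+q^2)(1+q+q^2+q^3)&&\text{for }SO(6)/(U(2)\times SO(2)), \\ Q(t)&=1+q+q^2+q^3&&\text{for }SO(6)/U(3), \\ R(t)&=1+q+2q^2+q^3+q^4&&\text{for }\widetilde G_2(\mathbb R^6). \end{aligned}$$ If one records formally the open two-dimensional interior, the three open edges, and the three vertices of the spherical triangle that is the orbit space of $SO(6)$ acting on $S(\Lambda^2\mathbb R^6)=S^{14}$, the resulting face inventory is $$\mathcal I_6(t)=t^2F(t)+3tE(t)+2Q(t)+R(t).$$ It satisfies the exact algebraic identity $$\mathcal I_6(t)=1+t^{14}+(1+t)\mathcal B_6(t),$$ where $$\mathcal B_6(t)=2+t+3t^2+3t^3+4t^4+5t^5+3t^6+6t^7+t^8+5t^9+3t^{11}.$$ In particular, $\mathcal B_6$ has nonnegative coefficients, so this six-dimensional bill passes the necessary nonnegativity test for cell-count polynomials: for a finite free complex the cell-count polynomial minus the Poincaré polynomial equals $(1+t)$ times a polynomial with nonnegative coefficients.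
   Context: The orbit space of $SO(6)$ on $S(\Lambda^2\mathbb R^6)$ is the spherical triangle of $\lambda$ with $\lambda_1\ge\lambda_2\ge|\lambda_3|$, $|\lambda|=1$, representing $\lambda_1e_1\wedge e_2+\lambda_2e_3\wedge e_4+\lambda_3e_5\wedge e_6$. The orbit type is $SO(6)/T^3$ over the interior, $SO(6)/(U(2)\times SO(2))$ over each of the three open edges, $SO(6)/U(3)\cong\mathbb{CP}^3$ over each of two vertices ($\lambda_1=\lambda_2=\pm\lambda_3$), and $\widetilde G_2(\mathbb R^6)=SO(6)/(SO(2)\times SO(4))$ (oriented $2$-planes) over the third vertex ($\lambda_2=\lambda_3=0$). The Bruhat polynomial of such a (partial) flag manifold counts its Bruhat cells by real dimension: it is the sum of $t^{2\ell(w)}$ over minimal-length coset representatives $w$ of $W/W_H$, with $W$ the Weyl group of type $D_3\cong A_3$, $W_H$ the Weyl group of the isotropy group and $\ell$ the length. The face inventory assigns to an open face of dimension $d$ the term $t^d$ times the Bruhat polynomial of its orbit type. *)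

theory Defs
  imports
    "HOL-Analysis.Analysis"
    "HOL-Computational_Algebra.Polynomial"
    "Jordan_Normal_Form.Matrix"
begin

no_notation Matrix.vec_index (infixl "$" 100)

section \<open>The action of SO(6) on bivectors\<close>

text \<open>
  \<open>\<Lambda>\<^sup>2\<real>\<^sup>6\<close> is identified with the skew-symmetric \<open>6 \<times> 6\<close> matrices via
  \<open>u \<and> v \<mapsto> u v\<^sup>T - v u\<^sup>T\<close>; the induced action of \<open>g\<close> is then
  \<open>A \<mapsto> g A g\<^sup>T\<close>.  The index type \<open>6\<close> has \<open>6 = 0\<close>, which is harmless: the six
  numerals \<open>1, \<dots>, 6\<close> are pairwise distinct.
\<close>

definition wedge :: "real^6 \<Rightarrow> real^6 \<Rightarrow> real^6^6" where
  "wedge u v = (\<chi> i j. u $ i * v $ j - v $ i * u $ j)"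

definition biv :: "real^3 \<Rightarrow> real^6^6" where
  "biv x = (x $ 1) *\<^sub>R wedge (axis 1 1) (axis 2 1)
         + (x $ 2) *\<^sub>R wedge (axis 3 1) (axis 4 1)
         + (x $ 3) *\<^sub>R wedge (axis 5 1) (axis 6 1)"

definition SO6 :: "(real^6^6) set" where
  "SO6 = {g. rotation_matrix g}"

definition act :: "real^6^6 \<Rightarrow> real^6^6 \<Rightarrow> real^6^6" where
  "act g A = g ** A ** transpose g"

definition isotropy :: "real^6^6 \<Rightarrow> (real^6^6) set" where
  "isotropy A = {g \<in> SO6. act g A = A}"

definition rotates :: "6 \<Rightarrow> 6 \<Rightarrow> real^6^6 \<Rightarrow> bool" where
  "rotates i j g \<longleftrightarrow> (\<exists>\<theta>.
     g *v axis i 1 = cos \<theta> *\<^sub>R axis i 1 + sin \<theta> *\<^sub>R axis j 1 \<and>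
     g *v axis j 1 = - sin \<theta> *\<^sub>R axis i 1 + cos \<theta> *\<^sub>R axis j 1)"

text \<open>
  An element of \<open>SO6\<close> that rotates a coordinate plane preserves the orthogonal complement of
  that plane and has determinant 1 there.  The unitary group of a coordinate subspace of even
  dimension consists of the orthogonal maps commuting with the complex structure given by
  \<open>biv (1,1,1)\<close> or \<open>biv (1,1,0)\<close> on that subspace.
\<close>

definition T3 :: "(real^6^6) set" where
  "T3 = {g \<in> SO6. rotates 1 2 g \<and> rotates 3 4 g \<and> rotates 5 6 g}"

definition U2_SO2 :: "(real^6^6) set" where
  "U2_SO2 = {g \<in> SO6. g ** biv (vector [1, 1, 0]) = biv (vector [1, 1, 0]) ** g \<and> rotates 5 6 g}"

definition U3 :: "(real^6^6) set" where
  "U3 = {g \<in> SO6. g ** biv (vector [1, 1, 1]) = biv (vector [1, 1, 1]) ** g}"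

definition SO2_SO4 :: "(real^6^6) set" where
  "SO2_SO4 = {g \<in> SO6. rotates 1 2 g}"


section \<open>Weyl groups and Bruhat polynomials\<close>

text \<open>
  \<open>biv\<close> parametrises the Lie algebra of the maximal torus \<open>T3\<close>.  For \<open>T3 \<subseteq> H \<subseteq> SO6\<close>, an
  element of \<open>H\<close> normalises \<open>T3\<close> iff it preserves this Lie algebra, and it acts trivially iff
  it lies in \<open>T3\<close>.  Hence \<open>weyl H\<close> is the Weyl group \<open>N\<^sub>H(T3) / T3\<close>, realised as a group of
  maps of \<open>\<real>\<^sup>3\<close>.
\<close>

definition weyl :: "(real^6^6) set \<Rightarrow> (real^3 \<Rightarrow> real^3) set" where
  "weyl H = {w. \<exists>g\<in>H. \<forall>x. act g (biv x) = biv (w x)}"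

text \<open>The simple roots of type \<open>D\<^sub>3\<close>; their chamber is \<open>x\<^sub>1 \<ge> x\<^sub>2 \<ge> \<bar>x\<^sub>3\<bar>\<close>.\<close>

definition simple_roots :: "(real^3) set" where
  "simple_roots = {vector [1, -1, 0], vector [0, 1, -1], vector [0, 1, 1]}"

definition reflection :: "real^3 \<Rightarrow> real^3 \<Rightarrow> real^3" where
  "reflection \<alpha> x = x - (2 * (x \<bullet> \<alpha>) / (\<alpha> \<bullet> \<alpha>)) *\<^sub>R \<alpha>"

definition weyl_length :: "(real^3 \<Rightarrow> real^3) \<Rightarrow> nat" where
  "weyl_length w =
     (LEAST n. \<exists>\<alpha>s. length \<alpha>s = n \<and> set \<alpha>s \<subseteq> simple_roots \<and>
                    w = foldr (\<lambda>\<alpha> v. reflection \<alpha> \<circ> v) \<alpha>s id)"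

definition minimal_reps :: "(real^6^6) set \<Rightarrow> (real^3 \<Rightarrow> real^3) set" where
  "minimal_reps H = {w \<in> weyl SO6. \<forall>v\<in>weyl H. weyl_length w \<le> weyl_length (w \<circ> v)}"

text \<open>
  The Bruhat polynomial of \<open>SO(6)/H\<close>.  It is only used for \<open>H \<supseteq> T3\<close> whose Weyl group is
  generated by simple reflections, so that each coset has exactly one representative of minimal
  length.
\<close>

definition bruhat_poly :: "(real^6^6) set \<Rightarrow> int poly" where
  "bruhat_poly H = (\<Sum>w\<in>minimal_reps H. monom 1 (2 * weyl_length w))"


section \<open>The face inventory of the orbit space\<close>

text \<open>
  The orbit space of \<open>SO(6)\<close> on the unit sphere of \<open>\<Lambda>\<^sup>2\<real>\<^sup>6\<close> is \<open>orbit_triangle\<close>, the point \<open>l\<close>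
  standing for the orbit of \<open>biv l\<close>.  Its sides are cut out by the simple roots; its open
  faces (interior, open edges, vertices) are the nonempty strata on which a given set of the
  defining inequalities is tight.
\<close>

definition orbit_triangle :: "(real^3) set" where
  "orbit_triangle = {l. norm l = 1 \<and> l $ 1 \<ge> l $ 2 \<and> l $ 2 \<ge> \<bar>l $ 3\<bar>}"

definition open_faces :: "(real^3) set set" where
  "open_faces =
     {{l \<in> orbit_triangle. \<forall>\<alpha>\<in>simple_roots. l \<bullet> \<alpha> = 0 \<longleftrightarrow> \<alpha> \<in> I} | I. I \<subseteq> simple_roots} - {{}}"

text \<open>A face of the spherical triangle has dimension one less than its linear span.\<close>

definition face_dim :: "(real^3) set \<Rightarrow> nat" where
  "face_dim f = dim f - 1"

text \<open>
  The points \<open>biv l\<close>, with \<open>l\<close> in a given open face, all have the same isotropy group.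
\<close>

definition face_isotropy :: "(real^3) set \<Rightarrow> (real^6^6) set" where
  "face_isotropy f = (THE H. \<forall>l\<in>f. isotropy (biv l) = H)"

definition face_inventory :: "int poly" where
  "face_inventory =
     (\<Sum>f\<in>open_faces. monom 1 (face_dim f) * bruhat_poly (face_isotropy f))"


section \<open>The nonnegativity test\<close>

definition passes_nonneg_test :: "int poly \<Rightarrow> int poly \<Rightarrow> bool" where
  "passes_nonneg_test c p \<longleftrightarrow> (\<exists>b. (\<forall>i. 0 \<le> coeff b i) \<and> c - p = (1 + [:0, 1:]) * b)"

text \<open>
  A finite free complex over an integral domain, in bases: the chain module in degree \<open>k\<close> is
  free of rank \<open>c k\<close> (spanned by the \<open>k\<close>-cells), and the matrix \<open>d k\<close> is the boundary map from
  degree \<open>k + 1\<close> to degree \<open>k\<close>.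
\<close>

definition finite_free_complex :: "(nat \<Rightarrow> nat) \<Rightarrow> (nat \<Rightarrow> 'a::idom mat) \<Rightarrow> bool" where
  "finite_free_complex c d \<longleftrightarrow>
     finite {k. c k \<noteq> 0} \<and>
     (\<forall>k. d k \<in> carrier_mat (c k) (c (Suc k))) \<and>
     (\<forall>k. d k * d (Suc k) = 0\<^sub>m (c k) (c (Suc (Suc k))))"

fun cycles :: "(nat \<Rightarrow> nat) \<Rightarrow> (nat \<Rightarrow> 'a::idom mat) \<Rightarrow> nat \<Rightarrow> 'a vec set" where
  "cycles c d 0 = carrier_vec (c 0)"
| "cycles c d (Suc k) = {v \<in> carrier_vec (c (Suc k)). d k *\<^sub>v v = 0\<^sub>v (c k)}"

definition boundaries :: "(nat \<Rightarrow> nat) \<Rightarrow> (nat \<Rightarrow> 'a::idom mat) \<Rightarrow> nat \<Rightarrow> 'a vec set" where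
  "boundaries c d k = (\<lambda>v. d k *\<^sub>v v) ` carrier_vec (c (Suc k))"

text \<open>
  The rank of the homology module: the maximal number \<open>n\<close> of cycles, given as the columns of a
  matrix \<open>V\<close>, whose classes modulo boundaries are linearly independent.
\<close>

definition betti :: "(nat \<Rightarrow> nat) \<Rightarrow> (nat \<Rightarrow> 'a::idom mat) \<Rightarrow> nat \<Rightarrow> nat" where
  "betti c d k = Max {n. \<exists>V\<in>carrier_mat (c k) n.
     (\<forall>j<n. col V j \<in> cycles c d k) \<and>
     (\<forall>a\<in>carrier_vec n. V *\<^sub>v a \<in> boundaries c d k \<longrightarrow> a = 0\<^sub>v n)}"

definition cell_count_poly :: "(nat \<Rightarrow> nat) \<Rightarrow> int poly" where
  "cell_count_poly c = (\<Sum>k | c k \<noteq> 0. monom (int (c k)) k)"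

definition poincare_poly :: "(nat \<Rightarrow> nat) \<Rightarrow> (nat \<Rightarrow> 'a::idom mat) \<Rightarrow> int poly" where
  "poincare_poly c d = (\<Sum>k | c k \<noteq> 0. monom (int (betti c d k)) k)"

end

theory Submission
  imports Defs "Jordan_Normal_Form.Determinant"
begin

text \<open>
The action of \<open>SO6\<close> on bivectors is controlled by the Weyl group acting on the parameters \<open>l\<close> of
\<open>biv l\<close>.  An element of \<open>SO6\<close> that represents \<open>w\<close> fixes \<open>biv l\<close> iff \<open>w l = l\<close>, so the Weyl
group of an isotropy group is a stabiliser (\<open>weyl_isotropy\<close>).  All four subgroups of the
statement are isotropy groups, of \<open>biv l\<close> with \<open>l\<close> equal to \<open>(3,2,0)\<close>, \<open>(2,2,0)\<close>, \<open>(1,1,1)\<close> and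
\<open>(1,0,0)\<close>, and so are the groups attached to the faces of the orbit triangle.  Hence every
Bruhat polynomial is found by minimising the length over the cosets of a stabiliser.

The Weyl group itself consists of the 24 signed permutations with an even number of sign changes
(\<open>weyl_SO6\<close>).  The matrices \<open>E\<^sub>k\<close> spanning the image of \<open>biv\<close> satisfy \<open>E\<^sub>k\<^sup>3 = - E\<^sub>k\<close> and
\<open>E\<^sub>k E\<^sub>l = 0\<close> for \<open>k \<noteq> l\<close>; conjugation preserves these relations, which forces a signed
permutation.  The parity of the signs comes from the determinant: an orthogonal matrix that
commutes with an orthogonal complex structure has determinant 1
(\<open>det_orthogonal_commuting_complex_structure\<close>), while an odd number of sign changes would make
such a matrix out of one of determinant \<open>- 1\<close>.  A signed permutation is recorded by the image of
the regular dominant point \<open>(3,2,1)\<close>, and its length is the number of positive roots that are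
negative there: a simple reflection changes this number by at most one, and some simple
reflection lowers it unless the point is dominant.  What remains is arithmetic with 24 integer
triples.

The chamber is the cone on the fundamental weights, which are dual to the simple roots up to scale.  A
face on which exactly the roots in \<open>I\<close> vanish spans the same space as the weights of the roots
outside \<open>I\<close>, which gives its dimension.  The isotropy group is constant along it, because
commuting with \<open>biv l\<close> only depends on which equations \<open>l\<^sub>a = l\<^sub>b\<close> and \<open>l\<^sub>a = - l\<^sub>b\<close> hold.  These
equations are determined by the face, with one exception: \<open>l\<^sub>3\<close> may vanish without lying on a
wall.  Then commutation alone says nothing about the third coordinate plane, and the determinant
decides (\<open>SO6_commute_third_plane\<close>).

For a finite free complex, let \<open>r\<^sub>k\<close> be the rank of the module of boundaries in degree \<open>k\<close>.  The
rank of a subquotient is additive along a chain of submodules (\<open>rel_rank_additive\<close>), and so the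
number of cells in degree \<open>k\<close> is \<open>r\<^sub>k\<^sub>-\<^sub>1 + \<beta>\<^sub>k + r\<^sub>k\<close>.  The quotient by \<open>1 + t\<close> is therefore the
polynomial with coefficients \<open>r\<^sub>k\<close>.
\<close>

section \<open>Ranks of subquotients over an integral domain\<close>

no_notation vec_index (infixl "$" 100)
notation vec_index (infixl "$v" 100)

definition is_submodule :: "nat \<Rightarrow> 'a::idom vec set \<Rightarrow> bool" where
  "is_submodule c N \<longleftrightarrow> N \<subseteq> carrier_vec c \<and> 0\<^sub>v c \<in> N \<and>
     (\<forall>x\<in>N. \<forall>y\<in>N. x + y \<in> N) \<and> (\<forall>r. \<forall>x\<in>N. r \<cdot>\<^sub>v x \<in> N)"

text \<open>
The numbers \<open>n\<close> such that \<open>n\<close> elements of \<open>M\<close>, the columns of a matrix, are linearly independent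
modulo \<open>N\<close>.  Their maximum is the rank of \<open>M / N\<close>.
\<close>

definition indep_sizes :: "nat \<Rightarrow> 'a::idom vec set \<Rightarrow> 'a vec set \<Rightarrow> nat set" where
  "indep_sizes c M N = {n. \<exists>V\<in>carrier_mat c n. (\<forall>j<n. col V j \<in> M) \<and>
     (\<forall>a\<in>carrier_vec n. V *\<^sub>v a \<in> N \<longrightarrow> a = 0\<^sub>v n)}"

definition rel_rank :: "nat \<Rightarrow> 'a::idom vec set \<Rightarrow> 'a vec set \<Rightarrow> nat" where
  "rel_rank c M N = Max (indep_sizes c M N)"

text \<open>
The Betti numbers are ranks of this kind, so additivity of \<open>rel_rank\<close> applies to them.
\<close>

lemma betti_rel_rank: "betti c d k = rel_rank (c k) (cycles c d k) (boundaries c d k)"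
  by (simp add: betti_def rel_rank_def indep_sizes_def)

definition hcat :: "'a mat \<Rightarrow> 'a mat \<Rightarrow> 'a mat" where
  "hcat U V = mat (dim_row U) (dim_col U + dim_col V)
     (\<lambda>(i, j). if j < dim_col U then U $$ (i, j) else V $$ (i, j - dim_col U))"

lemma hcat_carrier:
  "U \<in> carrier_mat c m \<Longrightarrow> V \<in> carrier_mat c n \<Longrightarrow> hcat U V \<in> carrier_mat c (m + n)"
  by (simp add: hcat_def)

lemma hcat_mult_append:
  assumes U: "U \<in> carrier_mat c m" and V: "V \<in> carrier_mat c n"
    and a: "a \<in> carrier_vec m" and b: "b \<in> carrier_vec n"
  shows "hcat U V *\<^sub>v (a @\<^sub>v b) = U *\<^sub>v a + V *\<^sub>v b"
proof (rule eq_vecI)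
  fix i assume "i < dim_vec (U *\<^sub>v a + V *\<^sub>v b)"
  then have i: "i < c" using U V by auto
  then have "row (hcat U V) i = row U i @\<^sub>v row V i"
    using U V by (intro eq_vecI) (auto simp: hcat_def)
  moreover have "(row U i @\<^sub>v row V i) \<bullet> (a @\<^sub>v b) = row U i \<bullet> a + row V i \<bullet> b"
    using U V a b i by (intro scalar_prod_append) auto
  ultimately show "(hcat U V *\<^sub>v (a @\<^sub>v b)) $v i = (U *\<^sub>v a + V *\<^sub>v b) $v i"
    using U V i by (simp add: hcat_def)
qed (use U V in \<open>simp add: hcat_def\<close>)

lemma col_hcat:
  assumes "U \<in> carrier_mat c m" and "V \<in> carrier_mat c n" and "j < m + n"
  shows "col (hcat U V) j = (if j < m then col U j else col V (j - m))"
  using assms by (intro eq_vecI) (auto simp: hcat_def)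

lemma mult_mat_vec_smult:
  fixes A :: "'a::comm_semiring_0 mat"
  assumes "A \<in> carrier_mat m n" and "x \<in> carrier_vec n"
  shows "A *\<^sub>v (r \<cdot>\<^sub>v x) = r \<cdot>\<^sub>v (A *\<^sub>v x)"
  using assms by (intro eq_vecI) (auto simp: scalar_prod_smult_right)

lemma append_eq_zero_iff:
  fixes a b :: "'a::zero vec"
  assumes "a \<in> carrier_vec m" "b \<in> carrier_vec n"
  shows "a @\<^sub>v b = 0\<^sub>v (m + n) \<longleftrightarrow> a = 0\<^sub>v m \<and> b = 0\<^sub>v n"
proof -
  have "0\<^sub>v (m + n) = 0\<^sub>v m @\<^sub>v (0\<^sub>v n :: 'a vec)" by (intro eq_vecI) auto
  then show ?thesis using append_vec_eq[OF assms(1) zero_carrier_vec, of b "0\<^sub>v n"] by (simp only:)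
qed

text \<open>
Padding with zero rows makes the matrix square and singular, and a singular square matrix over
an integral domain has a nonzero kernel vector.
\<close>

lemma wide_matrix_kernel:
  fixes A :: "'a::idom mat"
  assumes A: "A \<in> carrier_mat m p" and "m < p"
  shows "\<exists>v\<in>carrier_vec p. v \<noteq> 0\<^sub>v p \<and> A *\<^sub>v v = 0\<^sub>v m"
proof -
  define S where "S = mat p p (\<lambda>(i, j). if i < m then A $$ (i, j) else 0)"
  have S: "S \<in> carrier_mat p p" by (simp add: S_def)
  have "transpose_mat S *\<^sub>v unit_vec p m = 0\<^sub>v p"
    by (intro eq_vecI) (use \<open>m < p\<close> in \<open>auto simp: S_def\<close>)
  moreover have "unit_vec p m \<noteq> (0\<^sub>v p :: 'a vec)"
    using \<open>m < p\<close> by simp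
  ultimately have "Determinant.det (transpose_mat S) = 0"
    using det_0_iff_vec_prod_zero[of "transpose_mat S" p] S by (metis transpose_carrier_mat unit_vec_carrier)
  then have "Determinant.det S = 0" using Determinant.det_transpose[OF S] by simp
  then obtain v where v: "v \<in> carrier_vec p" "v \<noteq> 0\<^sub>v p" "S *\<^sub>v v = 0\<^sub>v p"
    using det_0_iff_vec_prod_zero[OF S] by auto
  have "A *\<^sub>v v = 0\<^sub>v m"
  proof (rule eq_vecI)
    fix i assume "i < dim_vec (0\<^sub>v m :: 'a vec)"
    then have i: "i < m" by simp
    have "row A i = row S i"
      using A i \<open>m < p\<close> by (intro eq_vecI) (auto simp: S_def)
    then have "(A *\<^sub>v v) $v i = (S *\<^sub>v v) $v i"
      using A S i \<open>m < p\<close> by simp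
    then show "(A *\<^sub>v v) $v i = 0\<^sub>v m $v i" using v(3) i \<open>m < p\<close> by simp
  qed (use A in auto)
  with v show ?thesis by auto
qed

lemma submodule_mult_mat_vec:
  fixes A :: "'a::idom mat"
  assumes N: "is_submodule c N" and A: "A \<in> carrier_mat c p" and cols: "\<And>j. j < p \<Longrightarrow> col A j \<in> N"
    and s: "s \<in> carrier_vec p"
  shows "A *\<^sub>v s \<in> N"
proof -
  define P where "P n = Matrix.vec c (\<lambda>i. \<Sum>j<n. A $$ (i, j) * s $v j)" for n
  have "P n \<in> N" if "n \<le> p" for n
    using that
  proof (induction n)
    case 0
    have "P 0 = 0\<^sub>v c" by (intro eq_vecI) (auto simp: P_def)
    then show ?case using N by (simp add: is_submodule_def)
  next
    case (Suc n)
    have "P (Suc n) = P n + (s $v n) \<cdot>\<^sub>v col A n"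
      using A Suc.prems by (intro eq_vecI) (auto simp: P_def)
    then show ?case using Suc N cols[of n] by (auto simp: is_submodule_def)
  qed
  moreover have "A *\<^sub>v s = P p"
    using A s by (intro eq_vecI) (auto simp: P_def scalar_prod_def lessThan_atLeast0)
  ultimately show ?thesis by simp
qed

context
  fixes c :: nat and M N :: "'a::idom vec set"
  assumes N0: "0\<^sub>v c \<in> N"
begin

lemma indep_sizes_le:
  assumes "n \<in> indep_sizes c M N" shows "n \<le> c"
proof (rule ccontr)
  assume "\<not> n \<le> c"
  obtain V where "V \<in> carrier_mat c n" and *: "\<And>a. a \<in> carrier_vec n \<Longrightarrow> V *\<^sub>v a \<in> N \<Longrightarrow> a = 0\<^sub>v n"
    using assms by (auto simp: indep_sizes_def)
  then show False
    using wide_matrix_kernel[of V c n] \<open>\<not> n \<le> c\<close> N0 by force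
qed

lemma finite_indep_sizes: "finite (indep_sizes c M N)"
  using indep_sizes_le by (meson finite_nat_set_iff_bounded_le)

lemma le_rel_rank: "n \<in> indep_sizes c M N \<Longrightarrow> n \<le> rel_rank c M N"
  by (simp add: rel_rank_def finite_indep_sizes)

lemma rel_rank_attained: "rel_rank c M N \<in> indep_sizes c M N"
proof -
  have "0 \<in> indep_sizes c M N"
    by (auto simp: indep_sizes_def intro!: bexI[of _ "0\<^sub>m c 0"])
  then show ?thesis unfolding rel_rank_def using finite_indep_sizes by (intro Max_in) auto
qed

lemma rel_rank_le: "rel_rank c M N \<le> c"
  using indep_sizes_le rel_rank_attained .

text \<open>
A family of maximal size that is independent modulo \<open>N\<close> spans \<open>M\<close> up to torsion modulo \<open>N\<close>: if
\<open>w\<close> is added to the family, there is a nontrivial relation, and \<open>w\<close> occurs in it.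
\<close>

lemma torsion_modulo_maximal:
  assumes V: "V \<in> carrier_mat c (rel_rank c M N)" and VM: "\<And>j. j < rel_rank c M N \<Longrightarrow> col V j \<in> M"
    and ind: "\<And>a. a \<in> carrier_vec (rel_rank c M N) \<Longrightarrow> V *\<^sub>v a \<in> N \<Longrightarrow> a = 0\<^sub>v (rel_rank c M N)"
    and w: "w \<in> M" "w \<in> carrier_vec c"
  shows "\<exists>r. \<exists>a\<in>carrier_vec (rel_rank c M N). r \<noteq> 0 \<and> V *\<^sub>v a + r \<cdot>\<^sub>v w \<in> N"
proof -
  let ?m = "rel_rank c M N"
  define W where "W = mat c 1 (\<lambda>(i, j). w $v i)"
  have W: "W \<in> carrier_mat c 1" by (simp add: W_def)
  have Ww: "W *\<^sub>v b = (b $v 0) \<cdot>\<^sub>v w" if "b \<in> carrier_vec 1" for b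
    using that w(2) by (intro eq_vecI) (auto simp: W_def scalar_prod_def)
  have "col W 0 = w" using w(2) by (intro eq_vecI) (auto simp: W_def)
  then have colM: "\<forall>j<?m + 1. col (hcat V W) j \<in> M"
    using VM w by (auto simp: col_hcat[OF V W] less_Suc_eq)
  (* By maximality the enlarged family is dependent; b holds the coefficient of w in a relation. *)
  have "\<not> ?m + 1 \<le> ?m" by simp
  then have "?m + 1 \<notin> indep_sizes c M N" using le_rel_rank by blast
  then obtain x where x: "x \<in> carrier_vec (?m + 1)" "hcat V W *\<^sub>v x \<in> N" "x \<noteq> 0\<^sub>v (?m + 1)"
    using hcat_carrier[OF V W] colM by (auto simp: indep_sizes_def)
  define a b where "a = vec_first x ?m" and "b = vec_last x 1"
  have xab: "x = a @\<^sub>v b" and a: "a \<in> carrier_vec ?m" and b: "b \<in> carrier_vec 1"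
    using x(1) by (auto simp: a_def b_def)
  have mem: "V *\<^sub>v a + (b $v 0) \<cdot>\<^sub>v w \<in> N"
    using x(2) by (simp add: xab hcat_mult_append[OF V W a b] Ww[OF b])
  moreover have "b $v 0 \<noteq> 0"
  proof
    assume b0: "b $v 0 = 0"
    then have "b = 0\<^sub>v 1" using b by (intro eq_vecI) auto
    have "(b $v 0) \<cdot>\<^sub>v w = 0\<^sub>v c" using b0 w(2) by (intro eq_vecI) auto
    then have "V *\<^sub>v a \<in> N" using mem V a by simp
    then have "a = 0\<^sub>v ?m" using ind a by blast
    with \<open>b = 0\<^sub>v 1\<close> x(3) show False using append_eq_zero_iff[OF a b] xab by simp
  qed
  ultimately show ?thesis using a by blast
qed

end

text \<open>
Maximal families for \<open>L / M\<close> and for \<open>M / N\<close> together are independent modulo \<open>N\<close>, which gives one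
inequality.  For the other one, each element of \<open>L\<close> has a nonzero multiple in the span of the two
families plus \<open>N\<close>; if there were more independent elements than there are members of the two
families, the matrix of coefficients would have a kernel vector, and this would be a relation
modulo \<open>N\<close>.
\<close>

lemma rel_rank_additive:
  fixes L M N :: "'a::idom vec set"
  assumes L: "is_submodule c L" and M: "is_submodule c M" and N: "is_submodule c N"
    and NM: "N \<subseteq> M" and MsubL: "M \<subseteq> L"
  shows "rel_rank c L N = rel_rank c L M + rel_rank c M N"
proof (rule antisym)
  let ?m = "rel_rank c L M" and ?n = "rel_rank c M N" and ?p = "rel_rank c L N"
  have zM: "0\<^sub>v c \<in> M" and zN: "0\<^sub>v c \<in> N" and Lc: "L \<subseteq> carrier_vec c" and Mc: "M \<subseteq> carrier_vec c"
    using L M N by (auto simp: is_submodule_def)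
  obtain U where U: "U \<in> carrier_mat c ?m" "\<And>j. j < ?m \<Longrightarrow> col U j \<in> L"
      "\<And>a. a \<in> carrier_vec ?m \<Longrightarrow> U *\<^sub>v a \<in> M \<Longrightarrow> a = 0\<^sub>v ?m"
    using rel_rank_attained[OF zM, of L] by (auto simp: indep_sizes_def)
  obtain V where V: "V \<in> carrier_mat c ?n" "\<And>j. j < ?n \<Longrightarrow> col V j \<in> M"
      "\<And>a. a \<in> carrier_vec ?n \<Longrightarrow> V *\<^sub>v a \<in> N \<Longrightarrow> a = 0\<^sub>v ?n"
    using rel_rank_attained[OF zN, of M] by (auto simp: indep_sizes_def)
  obtain W where W: "W \<in> carrier_mat c ?p" "\<And>j. j < ?p \<Longrightarrow> col W j \<in> L"
      "\<And>a. a \<in> carrier_vec ?p \<Longrightarrow> W *\<^sub>v a \<in> N \<Longrightarrow> a = 0\<^sub>v ?p"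
    using rel_rank_attained[OF zN, of L] by (auto simp: indep_sizes_def)
  define H where "H = hcat U V"
  have H: "H \<in> carrier_mat c (?m + ?n)" using hcat_carrier U V by (auto simp: H_def)
  have VM: "V *\<^sub>v b \<in> M" if "b \<in> carrier_vec ?n" for b
    using submodule_mult_mat_vec[OF M V(1) V(2) that] .

  show "?m + ?n \<le> ?p"
  proof (rule le_rel_rank[OF zN])
    have "x = 0\<^sub>v (?m + ?n)" if x: "x \<in> carrier_vec (?m + ?n)" and mem: "H *\<^sub>v x \<in> N" for x
    proof -
      define a b where "a = vec_first x ?m" and "b = vec_last x ?n"
      have xab: "x = a @\<^sub>v b" and a: "a \<in> carrier_vec ?m" and b: "b \<in> carrier_vec ?n"
        using x by (auto simp: a_def b_def)
      have *: "U *\<^sub>v a + V *\<^sub>v b \<in> N"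
        using mem by (simp add: xab H_def hcat_mult_append[OF U(1) V(1) a b])
      have "(-1) \<cdot>\<^sub>v (V *\<^sub>v b) \<in> M" using M VM[OF b] by (simp add: is_submodule_def)
      then have "(U *\<^sub>v a + V *\<^sub>v b) + (-1) \<cdot>\<^sub>v (V *\<^sub>v b) \<in> M"
        using M * NM by (auto simp: is_submodule_def)
      also have "(U *\<^sub>v a + V *\<^sub>v b) + (-1) \<cdot>\<^sub>v (V *\<^sub>v b) = U *\<^sub>v a"
        using U(1) V(1) by (intro eq_vecI) auto
      finally have a0: "a = 0\<^sub>v ?m" using U(3) a by blast
      then have "U *\<^sub>v a = 0\<^sub>v c" using U(1) by (intro eq_vecI) auto
      then have "V *\<^sub>v b \<in> N" using * V(1) b by simp
      then have "b = 0\<^sub>v ?n" using V(3) b by blast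
      with a0 show ?thesis using append_eq_zero_iff[OF a b] xab by simp
    qed
    moreover have "\<forall>j<?m + ?n. col H j \<in> L"
      using U(2) V(2) MsubL by (auto simp: H_def col_hcat[OF U(1) V(1)])
    ultimately show "?m + ?n \<in> indep_sizes c L N"
      using H by (auto simp: indep_sizes_def)
  qed

  have torsion: "\<exists>r. \<exists>a\<in>carrier_vec (?m + ?n). r \<noteq> 0 \<and> H *\<^sub>v a + r \<cdot>\<^sub>v w \<in> N" if wL: "w \<in> L" for w
  proof -
    have w: "w \<in> carrier_vec c" using wL Lc by auto
    obtain r a where r: "r \<noteq> 0" and a: "a \<in> carrier_vec ?m" and M1: "U *\<^sub>v a + r \<cdot>\<^sub>v w \<in> M"
      using torsion_modulo_maximal[OF zM U wL w] by blast
    obtain r' b where r': "r' \<noteq> 0" and b: "b \<in> carrier_vec ?n"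
      and N1: "V *\<^sub>v b + r' \<cdot>\<^sub>v (U *\<^sub>v a + r \<cdot>\<^sub>v w) \<in> N"
      using torsion_modulo_maximal[OF zN V M1 subsetD[OF Mc M1]] by blast
    have "H *\<^sub>v (r' \<cdot>\<^sub>v a @\<^sub>v b) + (r' * r) \<cdot>\<^sub>v w = V *\<^sub>v b + r' \<cdot>\<^sub>v (U *\<^sub>v a + r \<cdot>\<^sub>v w)"
      unfolding H_def using U(1) V(1) a b w
      by (subst hcat_mult_append) (auto intro!: eq_vecI simp: algebra_simps)
    with N1 r r' a b show ?thesis
      by (intro exI[of _ "r' * r"] bexI[of _ "r' \<cdot>\<^sub>v a @\<^sub>v b"]) auto
  qed
  show "?p \<le> ?m + ?n"
  proof (rule ccontr)
    assume "\<not> ?p \<le> ?m + ?n"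
    have "\<forall>j\<in>{..<?p}. \<exists>r. \<exists>a\<in>carrier_vec (?m + ?n). r \<noteq> 0 \<and> H *\<^sub>v a + r \<cdot>\<^sub>v col W j \<in> N"
      using torsion W(2) by blast
    then obtain r a where ra: "\<And>j. j < ?p \<Longrightarrow> a j \<in> carrier_vec (?m + ?n) \<and> r j \<noteq> 0 \<and>
        H *\<^sub>v a j + r j \<cdot>\<^sub>v col W j \<in> N"
      by (metis lessThan_iff)
    (* The columns of H A + W D lie in N, so a kernel vector s of A makes W (D s) an element of N. *)
    define A where "A = mat (?m + ?n) ?p (\<lambda>(i, j). a j $v i)"
    define D where "D = mat ?p ?p (\<lambda>(i, j). if i = j then r j else 0)"
    have A: "A \<in> carrier_mat (?m + ?n) ?p" and D: "D \<in> carrier_mat ?p ?p"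
      by (auto simp: A_def D_def)
    obtain s where s: "s \<in> carrier_vec ?p" "s \<noteq> 0\<^sub>v ?p" "A *\<^sub>v s = 0\<^sub>v (?m + ?n)"
      using wide_matrix_kernel[OF A] \<open>\<not> ?p \<le> ?m + ?n\<close> by auto
    have colA: "col A j = a j" if "j < ?p" for j
      using that ra[OF that] by (intro eq_vecI) (auto simp: A_def)
    have colD: "col D j = r j \<cdot>\<^sub>v unit_vec ?p j" if "j < ?p" for j
      using that by (intro eq_vecI) (auto simp: D_def)
    have "col (H * A + W * D) j = H *\<^sub>v a j + r j \<cdot>\<^sub>v col W j" if "j < ?p" for j
    proof -
      have "W *\<^sub>v unit_vec ?p j = col W j"
        using W(1) that by (intro eq_vecI) auto
      then have "W *\<^sub>v col D j = r j \<cdot>\<^sub>v col W j"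
        using W(1) that by (simp add: colD mult_mat_vec_smult)
      then show ?thesis
        unfolding Matrix.col_add[OF mult_carrier_mat[OF H A] mult_carrier_mat[OF W(1) D] that]
          col_mult2[OF H A that] col_mult2[OF W(1) D that]
        using that by (simp add: colA)
    qed
    then have "(H * A + W * D) *\<^sub>v s \<in> N"
      using H A W(1) D ra by (intro submodule_mult_mat_vec[OF N _ _ s(1)]) auto
    also have "(H * A + W * D) *\<^sub>v s = H *\<^sub>v (A *\<^sub>v s) + W *\<^sub>v (D *\<^sub>v s)"
      using H A W(1) D s(1) by (subst add_mult_distrib_mat_vec[of _ c ?p]) (auto simp: assoc_mult_mat_vec)
    also have "\<dots> = W *\<^sub>v (D *\<^sub>v s)"
      using H W(1) s(3) by (intro eq_vecI) auto
    finally have "D *\<^sub>v s = 0\<^sub>v ?p" using W(3) D s(1) by simp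
    have "s = 0\<^sub>v ?p"
    proof (rule eq_vecI)
      fix j assume "j < dim_vec (0\<^sub>v ?p :: 'a vec)"
      then have j: "j < ?p" by simp
      have "row D j = r j \<cdot>\<^sub>v unit_vec ?p j"
        using j by (intro eq_vecI) (auto simp: D_def)
      then have "(D *\<^sub>v s) $v j = r j * s $v j"
        using D s(1) j by (simp add: scalar_prod_left_unit)
      with \<open>D *\<^sub>v s = 0\<^sub>v ?p\<close> ra[OF j] j show "s $v j = 0\<^sub>v ?p $v j" by simp
    qed (use s in auto)
    with s(2) show False by simp
  qed
qed

lemma rel_rank_carrier: "rel_rank c (carrier_vec c) {0\<^sub>v c :: 'a::idom vec} = c"
proof (rule antisym)
  have "c \<in> indep_sizes c (carrier_vec c) {0\<^sub>v c :: 'a vec}"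
    by (auto simp: indep_sizes_def intro!: bexI[of _ "1\<^sub>m c"])
  then show "c \<le> rel_rank c (carrier_vec c) {0\<^sub>v c :: 'a vec}"
    by (intro le_rel_rank) auto
qed (simp add: rel_rank_le)

lemma rel_rank_self:
  assumes "is_submodule c M" shows "rel_rank c M M = 0"
  using rel_rank_additive[of c M M M] assms by simp

text \<open>
The isomorphism theorem in terms of families: vectors are independent modulo the kernel of \<open>D\<close> iff
their images are independent.
\<close>

lemma rel_rank_image:
  fixes D :: "'a::idom mat"
  assumes D: "D \<in> carrier_mat b c"
  shows "rel_rank c (carrier_vec c) {v \<in> carrier_vec c. D *\<^sub>v v = 0\<^sub>v b}
       = rel_rank b ((\<lambda>v. D *\<^sub>v v) ` carrier_vec c) {0\<^sub>v b}"
proof -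
  have "n \<in> indep_sizes c (carrier_vec c) {v \<in> carrier_vec c. D *\<^sub>v v = 0\<^sub>v b} \<longleftrightarrow>
        n \<in> indep_sizes b ((\<lambda>v. D *\<^sub>v v) ` carrier_vec c) {0\<^sub>v b}" (is "?l \<longleftrightarrow> ?r") for n
  proof
    assume ?l
    then obtain V where V: "V \<in> carrier_mat c n"
      "\<And>a. a \<in> carrier_vec n \<Longrightarrow> D *\<^sub>v (V *\<^sub>v a) = 0\<^sub>v b \<Longrightarrow> a = 0\<^sub>v n"
      by (auto simp: indep_sizes_def)
    then have "a = 0\<^sub>v n" if "a \<in> carrier_vec n" "(D * V) *\<^sub>v a = 0\<^sub>v b" for a
      using that D by (simp add: assoc_mult_mat_vec)
    moreover have "\<forall>j<n. col (D * V) j \<in> (\<lambda>v. D *\<^sub>v v) ` carrier_vec c"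
      using D V(1) by auto
    ultimately show ?r using D V(1) by (auto simp: indep_sizes_def intro!: bexI[of _ "D * V"])
  next
    assume ?r
    then obtain X where X: "X \<in> carrier_mat b n" "\<And>j. j < n \<Longrightarrow> col X j \<in> (\<lambda>v. D *\<^sub>v v) ` carrier_vec c"
      "\<And>a. a \<in> carrier_vec n \<Longrightarrow> X *\<^sub>v a = 0\<^sub>v b \<Longrightarrow> a = 0\<^sub>v n"
      by (auto simp: indep_sizes_def)
    then have "\<forall>j\<in>{..<n}. \<exists>v. v \<in> carrier_vec c \<and> col X j = D *\<^sub>v v" by auto
    then obtain v where v: "\<And>j. j < n \<Longrightarrow> v j \<in> carrier_vec c \<and> col X j = D *\<^sub>v v j"
      by (metis lessThan_iff)
    define V where "V = mat c n (\<lambda>(i, j). v j $v i)"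
    have V: "V \<in> carrier_mat c n" by (simp add: V_def)
    have colV: "col V j = v j" if "j < n" for j
      using that v[OF that] by (intro eq_vecI) (auto simp: V_def)
    have "X = D * V"
    proof (rule mat_col_eqI)
      fix j assume "j < dim_col (D * V)"
      then have "j < n" using V by simp
      then show "col X j = col (D * V) j" using D V v colV by simp
    qed (use D V X in auto)
    then show ?l using D V X(3)
      by (auto simp: indep_sizes_def assoc_mult_mat_vec intro!: bexI[of _ V])
  qed
  then have "indep_sizes c (carrier_vec c) {v \<in> carrier_vec c. D *\<^sub>v v = 0\<^sub>v b} =
      indep_sizes b ((\<lambda>v. D *\<^sub>v v) ` carrier_vec c) {0\<^sub>v b}" by blast
  then show ?thesis by (simp add: rel_rank_def)
qed

text \<open>
Applying additivity to \<open>0 \<subseteq> B \<subseteq> Z \<subseteq> C\<close> (boundaries, cycles, chains) in each degree, with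
\<open>C / Z\<close> isomorphic to the boundaries one degree lower, identifies the coefficients of the quotient
with the ranks of the modules of boundaries.
\<close>

lemma finite_free_complex_nonneg_test:
  fixes d :: "nat \<Rightarrow> 'a::idom mat"
  assumes "finite_free_complex c d"
  shows "passes_nonneg_test (cell_count_poly c) (poincare_poly c d)"
proof -
  have fin: "finite {k. c k \<noteq> 0}" and d: "\<And>k. d k \<in> carrier_mat (c k) (c (Suc k))"
    and dd: "\<And>k. d k * d (Suc k) = 0\<^sub>m (c k) (c (Suc (Suc k)))"
    using assms by (auto simp: finite_free_complex_def)
  define r where "r k = rel_rank (c k) (boundaries c d k) {0\<^sub>v (c k)}" for k
  have sub0: "is_submodule n {0\<^sub>v n :: 'a vec}" and subC: "is_submodule n (carrier_vec n :: 'a vec set)" for n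
    by (auto simp: is_submodule_def)
  have subZ: "is_submodule (c k) (cycles c d k)" for k
  proof (cases k)
    case (Suc l)
    have "d l *\<^sub>v (z \<cdot>\<^sub>v x) = 0\<^sub>v (c l)" if "x \<in> carrier_vec (c (Suc l))" "d l *\<^sub>v x = 0\<^sub>v (c l)" for x z
      unfolding mult_mat_vec_smult[OF d[of l] that(1)] that(2) by (intro eq_vecI) auto
    moreover have "d l *\<^sub>v (x + y) = 0\<^sub>v (c l)"
      if "x \<in> carrier_vec (c (Suc l))" "d l *\<^sub>v x = 0\<^sub>v (c l)"
        "y \<in> carrier_vec (c (Suc l))" "d l *\<^sub>v y = 0\<^sub>v (c l)" for x y
      unfolding mult_add_distrib_mat_vec[OF d[of l] that(1,3)] that(2,4) by (intro eq_vecI) auto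
    moreover have "d l *\<^sub>v 0\<^sub>v (c (Suc l)) = 0\<^sub>v (c l)"
      using d[of l] by (intro eq_vecI) auto
    ultimately show ?thesis unfolding Suc is_submodule_def cycles.simps by simp
  qed (simp add: subC)
  have subB: "is_submodule (c k) (boundaries c d k)" for k
  proof -
    have "0\<^sub>v (c k) \<in> boundaries c d k"
      unfolding boundaries_def
      by (rule image_eqI[of _ _ "0\<^sub>v (c (Suc k))"]) (use d[of k] in \<open>auto intro!: eq_vecI\<close>)
    moreover have "x + y \<in> boundaries c d k" if "x \<in> boundaries c d k" "y \<in> boundaries c d k" for x y
      using that unfolding boundaries_def
      by (elim imageE) (auto simp flip: mult_add_distrib_mat_vec[OF d[of k]])
    moreover have "z \<cdot>\<^sub>v x \<in> boundaries c d k" if "x \<in> boundaries c d k" for x z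
      using that unfolding boundaries_def
      by (elim imageE) (auto simp flip: mult_mat_vec_smult[OF d[of k]])
    ultimately show ?thesis
      using mult_mat_vec_carrier[OF d[of k]] unfolding is_submodule_def boundaries_def by blast
  qed
  have BZ: "boundaries c d k \<subseteq> cycles c d k" for k
  proof (cases k)
    case 0
    then show ?thesis using subB[of k] by (simp add: is_submodule_def)
  next
    case (Suc l)
    have "d l *\<^sub>v (d (Suc l) *\<^sub>v v) = 0\<^sub>v (c l)" if "v \<in> carrier_vec (c (Suc (Suc l)))" for v
      unfolding assoc_mult_mat_vec[OF d d that, symmetric] dd using that by (intro eq_vecI) auto
    then show ?thesis using Suc d[of k] by (auto simp: boundaries_def)
  qed
  have rank_nullity: "c k = rel_rank (c k) (carrier_vec (c k)) (cycles c d k) + (betti c d k + r k)" for k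
    using rel_rank_additive[OF subC subZ sub0, of k] rel_rank_additive[OF subZ subB sub0 _ BZ, of k]
      rel_rank_carrier[of "c k", where 'a = 'a] subZ[of k] subB[of k]
    by (simp add: betti_rel_rank r_def is_submodule_def)
  have c_0: "c 0 = betti c d 0 + r 0"
    using rank_nullity[of 0] rel_rank_self[OF subC] by simp
  have c_Suc: "c (Suc k) = r k + (betti c d (Suc k) + r (Suc k))" for k
    using rank_nullity[of "Suc k"] rel_rank_image[OF d[of k]] by (simp add: r_def boundaries_def)
  have r_le: "r k \<le> c k" and betti_le: "betti c d k \<le> c k" for k
    using rank_nullity[of k] by auto
  define b :: "int poly" where "b = (\<Sum>k | c k \<noteq> 0. monom (int (r k)) k)"
  have coeff_support: "coeff (\<Sum>k | c k \<noteq> 0. monom (int (f k)) k) n = int (f n)" if "f n \<le> c n" for f n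
    using that fin by (simp add: coeff_sum)
  have coeff_b: "coeff b n = int (r n)" for n
    unfolding b_def by (rule coeff_support) (rule r_le)
  have "cell_count_poly c - poincare_poly c d = (1 + [:0, 1:]) * b"
  proof (rule poly_eqI)
    fix n
    have "coeff (cell_count_poly c - poincare_poly c d) n = int (c n) - int (betti c d n)"
      unfolding cell_count_poly_def poincare_poly_def coeff_diff
      by (simp only: coeff_support betti_le order_refl)
    moreover have "coeff ((1 + [:0, 1:]) * b) n = int (r n) + (case n of 0 \<Rightarrow> 0 | Suc m \<Rightarrow> int (r m))"
      by (simp add: coeff_b distrib_right coeff_pCons split: nat.split)
    ultimately show "coeff (cell_count_poly c - poincare_poly c d) n = coeff ((1 + [:0, 1:]) * b) n"
      using c_0 c_Suc by (cases n) auto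
  qed
  moreover have "0 \<le> coeff b i" for i
    by (simp add: coeff_b)
  ultimately show ?thesis unfolding passes_nonneg_test_def by blast
qed

section \<open>Orthogonal matrices commuting with a complex structure\<close>

(* From here on, vectors, matrices, determinants and inner products are the Cartesian ones. *)
no_notation vec_index (infixl "$v" 100)
no_notation scalar_prod (infix "\<bullet>" 70)
hide_const (open) Matrix.mat Matrix.vec Matrix.row Matrix.orthogonal Determinant.det

lemma exhaust_6:
  fixes x :: 6
  shows "x = 1 \<or> x = 2 \<or> x = 3 \<or> x = 4 \<or> x = 5 \<or> x = 6"
proof (induct x)
  case (of_int z)
  then have "z = 0 \<or> z = 1 \<or> z = 2 \<or> z = 3 \<or> z = 4 \<or> z = 5" by simp arith
  then show ?case by auto
qed

lemma UNIV_6: "UNIV = {1, 2, 3, 4, 5, 6::6}"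
  using exhaust_6 by auto

lemma sum_6: "sum f (UNIV::6 set) = f 1 + f 2 + f 3 + f 4 + f 5 + f 6"
  unfolding UNIV_6 by (simp add: ac_simps)

lemma forall_6: "(\<forall>i::6. P i) \<longleftrightarrow> P 1 \<and> P 2 \<and> P 3 \<and> P 4 \<and> P 5 \<and> P 6"
  by (metis exhaust_6)

lemma inner_matrix_transpose:
  fixes A :: "real^'m^'n"
  shows "(A *v x) \<bullet> y = x \<bullet> (transpose A *v y)"
  by (metis dot_lmul_matrix inner_commute vector_transpose_matrix)

lemma transpose_add: "transpose (A + B) = transpose A + transpose B"
  by (simp add: transpose_def Finite_Cartesian_Product.vec_eq_iff)

lemma matrix_vector_mult_uminus:
  fixes A :: "real^'m^'n"
  shows "(- A) *v x = - (A *v x)" and "A *v (- x) = - (A *v x)"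
  by (simp_all add: matrix_vector_mult_def Finite_Cartesian_Product.vec_eq_iff sum_negf)

text \<open>
Otherwise \<open>det g = - 1\<close>.  The rotations \<open>h \<theta> = cos \<theta> + sin \<theta> J\<close> are squares of orthogonal matrices,
so \<open>g h(\<theta>)\<close> is orthogonal of determinant \<open>- 1\<close> and has the eigenvalue \<open>- 1\<close>.  Thus every number
\<open>- exp (- i \<theta>)\<close> is an eigenvalue of \<open>g\<close> as a unitary map for the complex structure \<open>J\<close>.
Eigenvectors for different eigenvalues are orthogonal, and infinitely many of them do not fit
into a finite-dimensional space.
\<close>

lemma det_orthogonal_commuting_complex_structure:
  fixes g J :: "real^'n^'n"
  assumes g: "orthogonal_matrix g" and skew: "transpose J = - J" and JJ: "J ** J = - mat 1"
    and comm: "g ** J = J ** g"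
  shows "det g = 1"
proof (rule ccontr)
  assume "det g \<noteq> 1"
  then have detg: "det g = -1" using det_orthogonal_matrix[OF g] by auto
  define h where "h \<theta> = cos \<theta> *\<^sub>R mat 1 + sin \<theta> *\<^sub>R J" for \<theta>
  have h_apply: "h \<theta> *v v = cos \<theta> *\<^sub>R v + sin \<theta> *\<^sub>R (J *v v)" for \<theta> v
    by (simp add: h_def matrix_vector_mult_add_rdistrib flip: scaleR_matrix_vector_assoc)
  have JJv: "J *v (J *v v) = - v" for v
    by (simp add: matrix_vector_mul_assoc JJ matrix_vector_mult_uminus)
  have gJ: "g *v (J *v v) = J *v (g *v v)" for v
    by (simp add: matrix_vector_mul_assoc comm)
  have gt: "transpose g ** g = mat 1" "g ** transpose g = mat 1"
    using g by (auto simp: orthogonal_matrix_def)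
  have h_add: "h \<alpha> *v (h \<beta> *v v) = h (\<alpha> + \<beta>) *v v" for \<alpha> \<beta> v
    by (simp add: h_apply JJv matrix_vector_right_distrib matrix_vector_mult_scaleR cos_add sin_add algebra_simps)
  have h_mult: "h \<alpha> ** h \<beta> = h (\<alpha> + \<beta>)" for \<alpha> \<beta>
    by (simp add: matrix_eq h_add flip: matrix_vector_mul_assoc)
  have ht: "transpose (h \<theta>) = h (- \<theta>)" for \<theta>
    by (simp add: h_def transpose_add transpose_scalar skew)
  have h0: "h 0 = mat 1" by (simp add: h_def)
  have h_orth: "orthogonal_matrix (h \<theta>)" for \<theta>
    by (simp add: orthogonal_matrix_def ht h_mult h0)
  have det_h: "det (h \<theta>) = 1" for \<theta>
  proof -
    have "det (h \<theta>) = det (h (\<theta> / 2)) * det (h (\<theta> / 2))"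
      by (simp add: h_mult flip: det_mul)
    then show ?thesis using det_orthogonal_matrix[OF h_orth[of "\<theta> / 2"]] by auto
  qed
  (* Since G = g h(\<theta>) is orthogonal, G (1 + G)\<^sup>T = 1 + G, and det G = -1 gives det (1 + G) = 0. *)
  have "\<exists>u. u \<noteq> 0 \<and> g *v u = - (h (- \<theta>) *v u)" for \<theta>
  proof -
    define G where "G = g ** h \<theta>"
    have G: "orthogonal_matrix G" "det G = -1"
      using g h_orth det_h detg by (auto simp: G_def orthogonal_matrix_mul det_mul)
    have "G ** transpose (mat 1 + G) = mat 1 + G"
      using G(1) by (simp add: transpose_add matrix_add_ldistrib orthogonal_matrix_def add.commute)
    then have "det (mat 1 + G) = - det (mat 1 + G)"
      using G(2) det_mul[of G "transpose (mat 1 + G)"] by (simp add: Determinants.det_transpose)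
    then have "\<not> invertible (mat 1 + G)" by (simp add: invertible_det_nz)
    then obtain v where v: "v \<noteq> 0" "(mat 1 + G) *v v = 0"
      using matrix_left_invertible_ker[of "mat 1 + G"] invertible_left_inverse by blast
    define u where "u = h \<theta> *v v"
    have vu: "v = h (- \<theta>) *v u" by (simp add: u_def h_add h0)
    with v(1) have "u \<noteq> 0" by auto
    moreover have "g *v u = - v"
      using v(2) by (simp add: u_def G_def matrix_vector_mult_add_rdistrib matrix_vector_mul_assoc add_eq_0_iff)
    ultimately show ?thesis using vu by auto
  qed
  then obtain u where u: "\<And>\<theta>. u \<theta> \<noteq> 0" "\<And>\<theta>. g *v u \<theta> = - (h (- \<theta>) *v u \<theta>)" by metis
  have g_inner: "x \<bullet> y = (g *v x) \<bullet> (g *v y)" for x y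
    by (simp add: inner_matrix_transpose matrix_vector_mul_assoc gt)
  have h_inner: "(h (- \<alpha>) *v x) \<bullet> (h (- \<beta>) *v y) = x \<bullet> (h (\<alpha> - \<beta>) *v y)" for \<alpha> \<beta> x y
    by (simp add: inner_matrix_transpose ht h_add)
  have orth: "u \<alpha> \<bullet> u \<beta> = 0" if "sin (\<alpha> - \<beta>) \<noteq> 0" for \<alpha> \<beta>
  proof -
    (* p and r are the real and imaginary part of the Hermitian product of the two eigenvectors. *)
    define p r where "p = u \<alpha> \<bullet> u \<beta>" and "r = u \<alpha> \<bullet> (J *v u \<beta>)"
    define c s where "c = cos (\<alpha> - \<beta>)" and "s = sin (\<alpha> - \<beta>)"
    have "p = (h (- \<alpha>) *v u \<alpha>) \<bullet> (h (- \<beta>) *v u \<beta>)"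
      unfolding p_def by (subst g_inner) (simp add: u)
    also have "\<dots> = c * p + s * r"
      unfolding h_inner by (simp add: h_apply p_def r_def c_def s_def inner_add_right)
    finally have p: "p = c * p + s * r" .
    have "r = (h (- \<alpha>) *v u \<alpha>) \<bullet> (J *v (h (- \<beta>) *v u \<beta>))"
      unfolding r_def by (subst g_inner) (simp add: u gJ matrix_vector_mult_uminus)
    also have "J *v (h (- \<beta>) *v u \<beta>) = h (- \<beta>) *v (J *v u \<beta>)"
      by (simp add: h_apply matrix_vector_mult_diff_distrib matrix_vector_mult_scaleR)
    also have "(h (- \<alpha>) *v u \<alpha>) \<bullet> (h (- \<beta>) *v (J *v u \<beta>)) = c * r - s * p"
      unfolding h_inner by (simp add: h_apply p_def r_def c_def s_def inner_diff_right JJv)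
    finally have r: "r = c * r - s * p" .
    have "((1 - c)\<^sup>2 + s\<^sup>2) * p = (1 - c) * (p - (c * p + s * r)) + s * (r - (c * r - s * p))"
      by (simp add: power2_eq_square algebra_simps)
    then have "((1 - c)\<^sup>2 + s\<^sup>2) * p = 0"
      using p r by simp
    moreover have "(1 - c)\<^sup>2 + s\<^sup>2 \<noteq> 0"
      using that by (simp add: s_def sum_power2_eq_zero_iff)
    ultimately show ?thesis by (auto simp: p_def)
  qed
  (* All differences of angles in the unit interval are smaller than pi. *)
  have sin_nz: "sin (\<alpha> - \<beta>) \<noteq> 0" if "\<alpha> \<in> {0<..<1}" "\<beta> \<in> {0<..<1}" "\<alpha> \<noteq> \<beta>" for \<alpha> \<beta> :: real
    using sin_eq_0_pi[of "\<alpha> - \<beta>"] that pi_gt3 by auto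
  have "inj_on u {0<..<1}"
    by (rule inj_onI) (metis inner_eq_zero_iff orth sin_nz u(1))
  moreover have "pairwise orthogonal (u ` {0<..<1})"
    unfolding pairwise_def real_inner_class.orthogonal_def using orth sin_nz by fastforce
  then have "finite (u ` {0<..<1})" by (rule pairwise_orthogonal_imp_finite)
  ultimately show False using finite_imageD infinite_Ioo[of "0::real" 1] by auto
qed

section \<open>Commuting with a bivector\<close>

lemma matrix_add_rdistrib: "(A + B) ** C = A ** C + B ** (C :: 'a::semiring_1^'p^'n)"
  by (simp add: matrix_matrix_mult_def Finite_Cartesian_Product.vec_eq_iff distrib_right sum.distrib)

lemma act_add: "act g (A + B) = act g A + act g B"
  by (simp add: act_def matrix_add_ldistrib matrix_add_rdistrib)

lemma act_scaleR: "act g (c *\<^sub>R A) = c *\<^sub>R act g A"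
  by (simp add: act_def matrix_scalar_ac scalar_matrix_assoc)

lemma act_diff: "act g (A - B) = act g A - act g B"
  using act_add[of g A "(-1) *\<^sub>R B"] by (simp add: act_scaleR[of g "-1", simplified])

lemma act_compose: "act g (act h A) = act (g ** h) A"
  by (simp add: act_def matrix_transpose_mul matrix_mul_assoc)

lemma act_id: "act (mat 1) A = A"
  by (simp add: act_def)

lemma act_fixes_iff_commute:
  assumes "orthogonal_matrix g" shows "act g A = A \<longleftrightarrow> g ** A = A ** g"
proof
  assume "act g A = A"
  then have "g ** A ** (transpose g ** g) = A ** g"
    by (metis act_def matrix_mul_assoc)
  then show "g ** A = A ** g" using assms by (simp add: orthogonal_matrix_def)
next
  assume "g ** A = A ** g"
  then have "act g A = A ** (g ** transpose g)" by (simp add: act_def matrix_mul_assoc)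
  then show "act g A = A" using assms by (simp add: orthogonal_matrix_def)
qed

lemma SO6_orthogonal: "g \<in> SO6 \<Longrightarrow> orthogonal_matrix g"
  by (simp add: SO6_def rotation_matrix_def)

lemma isotropy_iff: "g \<in> isotropy A \<longleftrightarrow> g \<in> SO6 \<and> g ** A = A ** g"
  using act_fixes_iff_commute SO6_orthogonal by (auto simp: isotropy_def)

lemma biv_add: "biv (x + y) = biv x + biv y"
  by (simp add: biv_def algebra_simps)

lemma biv_scaleR: "biv (c *\<^sub>R x) = c *\<^sub>R biv x"
  by (simp add: biv_def algebra_simps)

lemma biv_diff: "biv (x - y) = biv x - biv y"
  by (simp add: biv_def algebra_simps)

text \<open>
The coordinate planes are spanned by \<open>e\<^sub>1, e\<^sub>2\<close>, by \<open>e\<^sub>3, e\<^sub>4\<close> and by \<open>e\<^sub>5, e\<^sub>6\<close>.  The next three functions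
give the other axis in the plane of an axis, the number of that plane, and the sign with which
\<open>biv x\<close> maps the axis to its partner.  With them a statement about all 36 matrix entries needs no
case distinction.
\<close>

definition partner :: "6 \<Rightarrow> 6" where
  "partner i = (if i = 1 then 2 else if i = 2 then 1 else if i = 3 then 4
     else if i = 4 then 3 else if i = 5 then 6 else 5)"

definition plane :: "6 \<Rightarrow> 3" where
  "plane i = (if i = 1 \<or> i = 2 then 1 else if i = 3 \<or> i = 4 then 2 else 3)"

definition orient :: "6 \<Rightarrow> real" where
  "orient i = (if i = 1 \<or> i = 3 \<or> i = 5 then 1 else - 1)"

lemma partner_partner [simp]: "partner (partner i) = i"
  and plane_partner [simp]: "plane (partner i) = plane i"
  and orient_partner [simp]: "orient (partner i) = - orient i"
  and orient_square [simp]: "orient i * orient i = 1"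
  and orient_nonzero [simp]: "orient i \<noteq> 0"
  using exhaust_6[of i] by (auto simp: partner_def plane_def orient_def)

lemma partner_eq_iff: "i = partner j \<longleftrightarrow> j = partner i"
  by (metis partner_partner)

lemma biv_nth: "biv x $ i $ j = (if j = partner i then orient i * x $ plane i else 0)"
proof -
  have "\<forall>i j. biv x $ i $ j = (if j = partner i then orient i * x $ plane i else 0)"
    by (simp add: forall_6 biv_def wedge_def axis_def partner_def plane_def orient_def)
  then show ?thesis by blast
qed

lemma biv_inj: "biv x = biv y \<longleftrightarrow> x = y"
proof
  assume "biv x = biv y"
  then have "biv x $ 1 $ 2 = biv y $ 1 $ 2" "biv x $ 3 $ 4 = biv y $ 3 $ 4" "biv x $ 5 $ 6 = biv y $ 5 $ 6"
    by auto
  then show "x = y"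
    by (simp add: biv_nth partner_def plane_def orient_def Finite_Cartesian_Product.vec_eq_iff forall_3)
qed simp

lemma commute_biv_iff:
  "g ** biv l = biv l ** g \<longleftrightarrow>
     (\<forall>i j. - orient j * l $ plane j * g $ i $ partner j = orient i * l $ plane i * g $ partner i $ j)"
proof -
  have "(g ** biv l) $ i $ j = - orient j * l $ plane j * g $ i $ partner j" for i j
    by (simp add: matrix_matrix_mult_def biv_nth partner_eq_iff[of j] if_distrib cong: if_cong)
  moreover have "(biv l ** g) $ i $ j = orient i * l $ plane i * g $ partner i $ j" for i j
    by (simp add: matrix_matrix_mult_def biv_nth if_distrib[of "\<lambda>a. a * _"] cong: if_cong)
  ultimately show ?thesis by (simp add: Finite_Cartesian_Product.vec_eq_iff)
qed

text \<open>
The factors \<open>e\<close> and \<open>f\<close> stand for signs; moving both to the right-hand side turns an entry of the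
commutation relation into an equation without signs on the left.
\<close>

lemma signed_cross_eq:
  fixes e f x y p t :: real
  assumes "- f * y * p = e * x * t" and "e * e = 1" and "f * f = 1"
  shows "y * p = x * (- (e * f) * t)"
proof -
  have "y * p = (f * f) * (y * p)" using assms by simp
  also have "\<dots> = - f * (- f * y * p)" by simp
  also have "\<dots> = - f * (e * x * t)" by (simp only: assms(1))
  finally show ?thesis by (simp add: mult_ac)
qed

text \<open>
Entry by entry, commutation with \<open>biv l\<close> is a pair of equations \<open>l\<^sub>b p = l\<^sub>a s\<close> and \<open>l\<^sub>b s = l\<^sub>a p\<close> between
two entries of \<open>g\<close>, up to a sign.  They force \<open>p = s = 0\<close> if \<open>l\<^sub>a\<close> and \<open>l\<^sub>b\<close> have different absolute
values, \<open>p = s\<close> or \<open>p = - s\<close> if these are equal and nonzero, and nothing if \<open>l\<^sub>a = l\<^sub>b = 0\<close>.  The case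
\<open>a = b\<close> of the last hypothesis makes \<open>m\<close> vanish wherever \<open>l\<close> does.
\<close>

lemma commute_biv_transfer:
  assumes comm: "g ** biv l = biv l ** g"
    and eq: "\<And>a b. l $ a = l $ b \<Longrightarrow> m $ a = m $ b"
    and opp: "\<And>a b. l $ a = - l $ b \<Longrightarrow> m $ a = - m $ b"
  shows "g ** biv m = biv m ** g"
  unfolding commute_biv_iff
proof (intro allI)
  fix i j
  define a b where "a = plane i" and "b = plane j"
  define p s where "p = g $ i $ partner j" and "s = - (orient i * orient j) * g $ partner i $ j"
  have o: "orient i * orient i = 1" "orient j * orient j = 1" by simp_all
  have "- orient j * l $ b * p = orient i * l $ a * g $ partner i $ j"
    using comm[unfolded commute_biv_iff] by (simp add: a_def b_def p_def)
  then have 1: "l $ b * p = l $ a * s"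
    unfolding s_def using o by (intro signed_cross_eq) auto
  have "- orient (partner j) * l $ plane (partner j) * g $ partner i $ partner (partner j) =
      orient (partner i) * l $ plane (partner i) * g $ partner (partner i) $ partner j"
    using comm[unfolded commute_biv_iff] by blast
  then have "- orient i * l $ a * p = orient j * l $ b * g $ partner i $ j"
    by (simp add: a_def b_def p_def)
  then have "l $ a * p = l $ b * (- (orient j * orient i) * g $ partner i $ j)"
    using o by (intro signed_cross_eq) auto
  then have 2: "l $ b * s = l $ a * p"
    by (simp add: s_def mult.commute)
  have "m $ b * p = m $ a * s"
  proof (cases "l $ a = l $ b \<or> l $ a = - l $ b")
    case True
    then show ?thesis
    proof
      assume *: "l $ a = l $ b"
      show ?thesis
      proof (cases "l $ b = 0")
        case True
        with * eq[of a b] opp[of a b] show ?thesis by simp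
      next
        case False
        with 1 * have "p = s" by simp
        with eq[OF *] show ?thesis by simp
      qed
    next
      assume *: "l $ a = - l $ b"
      show ?thesis
      proof (cases "l $ b = 0")
        case True
        with * eq[of a b] opp[of a b] show ?thesis by simp
      next
        case False
        have "l $ b * (p + s) = 0" using 1 * by (simp add: distrib_left)
        with False have "p = - s" by (simp add: eq_neg_iff_add_eq_0)
        with opp[OF *] show ?thesis by simp
      qed
    qed
  next
    case False
    have "((l $ b)\<^sup>2 - (l $ a)\<^sup>2) * p = l $ b * (l $ b * p - l $ a * s) + l $ a * (l $ b * s - l $ a * p)"
      "((l $ b)\<^sup>2 - (l $ a)\<^sup>2) * s = l $ b * (l $ b * s - l $ a * p) + l $ a * (l $ b * p - l $ a * s)"
      by (simp_all add: power2_eq_square algebra_simps)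
    then have "((l $ b)\<^sup>2 - (l $ a)\<^sup>2) * p = 0" "((l $ b)\<^sup>2 - (l $ a)\<^sup>2) * s = 0"
      using 1 2 by simp_all
    moreover have "(l $ b)\<^sup>2 - (l $ a)\<^sup>2 \<noteq> 0"
      using False by (auto simp: power2_eq_iff)
    ultimately show ?thesis by simp
  qed
  then have "- orient j * m $ b * p = - orient j * (m $ a * s)" by simp
  also have "\<dots> = (orient j * orient j) * (orient i * m $ a * g $ partner i $ j)"
    unfolding s_def by (simp only: mult_ac mult_minus_left mult_minus_right minus_minus)
  finally show "- orient j * m $ plane j * g $ i $ partner j = orient i * m $ plane i * g $ partner i $ j"
    by (simp add: a_def b_def p_def)
qed

lemma biv_transpose: "transpose (biv x) = - biv x"
proof -
  have "transpose (biv x) $ i $ j = (- biv x) $ i $ j" for i j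
  proof (cases "j = partner i")
    case True
    then show ?thesis by (simp add: biv_nth transpose_def)
  next
    case False
    then have "i \<noteq> partner j" using partner_eq_iff by blast
    with False show ?thesis by (simp add: biv_nth transpose_def)
  qed
  then show ?thesis by (simp add: Finite_Cartesian_Product.vec_eq_iff)
qed

lemma biv_mult_nth: "(biv x ** biv y) $ i $ j = (if i = j then - (x $ plane i * y $ plane i) else 0)"
proof -
  have "(biv x ** biv y) $ i $ j = orient i * x $ plane i * biv y $ partner i $ j"
    by (simp add: matrix_matrix_mult_def biv_nth[of x] if_distrib[of "\<lambda>a. a * _"] cong: if_cong)
  then show ?thesis using orient_square[of i] by (auto simp: biv_nth)
qed

text \<open>
A reflection that normalises the torus.  It has determinant \<open>- 1\<close> and changes one sign, so it is the
comparison element for questions of parity.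
\<close>

definition flip6 :: "real^6^6" where
  "flip6 = (\<chi> i j. if i = j then (if i = 6 then - 1 else 1) else 0)"

lemma flip6_mult_nth:
  "(flip6 ** A) $ i $ j = (if i = 6 then - A $ i $ j else A $ i $ j)"
  "(A ** flip6) $ i $ j = (if j = 6 then - A $ i $ j else A $ i $ j)"
  by (simp_all add: flip6_def matrix_matrix_mult_def if_distrib[of "\<lambda>a. a * _"] if_distrib[of "\<lambda>a. _ * a"]
      eq_commute[of _ j] cong: if_cong)

lemma flip6_orthogonal: "orthogonal_matrix flip6"
proof -
  have "transpose flip6 = flip6"
    by (auto simp: transpose_def flip6_def Finite_Cartesian_Product.vec_eq_iff)
  moreover have "flip6 ** flip6 = mat 1"
    by (auto simp: Finite_Cartesian_Product.vec_eq_iff flip6_mult_nth) (simp_all add: flip6_def Finite_Cartesian_Product.mat_def)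
  ultimately show ?thesis by (simp add: orthogonal_matrix_def)
qed

lemma det_flip6: "det flip6 = - 1"
proof -
  have diag: "flip6 $ i $ i = (if i = 6 then - 1 else 1)" for i
    by (simp add: flip6_def)
  have "det flip6 = (\<Prod>i\<in>UNIV. flip6 $ i $ i)"
    by (rule det_diagonal) (simp add: flip6_def)
  also have "\<dots> = - 1"
    unfolding diag by (simp add: prod.delta)
  finally show ?thesis .
qed

lemma act_flip6: "act flip6 (biv x) = biv (vector [x $ 1, x $ 2, - x $ 3])"
proof -
  have "(flip6 ** biv x) $ i $ j = (biv (vector [x $ 1, x $ 2, - x $ 3]) ** flip6) $ i $ j" for i j
    using exhaust_6[of i] exhaust_6[of j]
    by (auto simp: flip6_mult_nth biv_nth partner_def plane_def orient_def)
  then have "flip6 ** biv x = biv (vector [x $ 1, x $ 2, - x $ 3]) ** flip6"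
    by (simp add: Finite_Cartesian_Product.vec_eq_iff)
  moreover have "flip6 ** transpose flip6 = mat 1"
    using flip6_orthogonal by (simp add: orthogonal_matrix_def)
  ultimately show ?thesis
    by (simp add: act_def flip: matrix_mul_assoc)
qed

lemma det_commuting_biv:
  assumes "orthogonal_matrix g" and "g ** biv l = biv l ** g" and "\<And>a. l $ a * l $ a = 1"
  shows "det g = 1"
  using assms(1) biv_transpose _ assms(2)
proof (rule det_orthogonal_commuting_complex_structure)
  show "biv l ** biv l = - mat 1"
    by (simp add: Finite_Cartesian_Product.vec_eq_iff biv_mult_nth assms(3) Finite_Cartesian_Product.mat_def)
qed

lemma det_commuting_biv_ones:
  assumes "orthogonal_matrix g" and "g ** biv (vector [1, 1, 1]) = biv (vector [1, 1, 1]) ** g"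
  shows "det g = 1"
proof (rule det_commuting_biv[OF assms])
  show "(vector [1, 1, 1] :: real^3) $ a * vector [1, 1, 1] $ a = 1" for a
    using exhaust_3[of a] by auto
qed

text \<open>
Commuting with \<open>biv (1,1,0)\<close> makes \<open>g\<close> preserve the third plane, on which it is a rotation or a
reflection.  If it were a reflection, then composition with \<open>flip6\<close> would turn it into a rotation
there, and the product would commute with the complex structure \<open>biv (1,1,1)\<close>, so have determinant
1.  But its determinant is \<open>- 1\<close>.
\<close>

lemma SO6_commute_third_plane:
  assumes g: "g \<in> SO6" and comm: "g ** biv (vector [1, 1, 0]) = biv (vector [1, 1, 0]) ** g"
  shows "g ** biv (vector [0, 0, 1]) = biv (vector [0, 0, 1]) ** g"
proof -
  have og: "orthogonal_matrix g" and dg: "det g = 1"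
    using g by (auto simp: SO6_def rotation_matrix_def)
  have l: "(vector [1, 1, 0] :: real^3) $ a = (if a = 3 then 0 else 1)" for a
    using exhaust_3[of a] by auto
  have z1: "g $ i $ j = 0" if "plane i \<noteq> 3" "plane j = 3" for i j
    using comm[unfolded commute_biv_iff, rule_format, of j "partner i"] that by (simp add: l)
  have z2: "g $ i $ j = 0" if "plane i = 3" "plane j \<noteq> 3" for i j
    using comm[unfolded commute_biv_iff, rule_format, of "partner j" i] that by (simp add: l)
  have z12: "g $ 1 $ 5 = 0" "g $ 2 $ 5 = 0" "g $ 3 $ 5 = 0" "g $ 4 $ 5 = 0"
      "g $ 1 $ 6 = 0" "g $ 2 $ 6 = 0" "g $ 3 $ 6 = 0" "g $ 4 $ 6 = 0"
    by (rule z1; simp add: plane_def)+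
  have z3: "g $ 5 $ 1 = 0" "g $ 5 $ 2 = 0" "g $ 5 $ 3 = 0" "g $ 5 $ 4 = 0"
      "g $ 6 $ 1 = 0" "g $ 6 $ 2 = 0" "g $ 6 $ 3 = 0" "g $ 6 $ 4 = 0"
    by (rule z2; simp add: plane_def)+
  note z = z12 z3
  have "g ** transpose g = mat 1" using og by (simp add: orthogonal_matrix_def)
  then have "(g ** transpose g) $ i $ j = mat 1 $ i $ j" for i j by simp
  then have rows: "(\<Sum>k\<in>UNIV. g $ i $ k * g $ j $ k) = (if i = j then 1 else 0)" for i j
    by (simp add: matrix_matrix_mult_def transpose_def Finite_Cartesian_Product.mat_def)
  define a b c d where "a = g $ 5 $ 5" and "b = g $ 5 $ 6" and "c = g $ 6 $ 5" and "d = g $ 6 $ 6"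
  note abcd = a_def[symmetric] b_def[symmetric] c_def[symmetric] d_def[symmetric]
  have 1: "a * a + b * b = 1" and 2: "c * c + d * d = 1" and 3: "a * c + b * d = 0"
    using rows[of 5 5] rows[of 6 6] rows[of 5 6] by (simp_all add: sum_6 z abcd)
  (* The block in the third plane is orthogonal; its determinant separates rotations from reflections. *)
  have det_sq: "(a * d - b * c)\<^sup>2 = (a * a + b * b) * (c * c + d * d) - (a * c + b * d)\<^sup>2"
    by (simp add: power2_eq_square algebra_simps)
  note rows2 = 1 2
  have "(a * d - b * c)\<^sup>2 = 1" using det_sq 1 2 3 by simp
  then consider "a * d - b * c = 1" | "a * d - b * c = - 1" by (auto simp: power2_eq_1_iff)
  then show ?thesis
  proof cases
    case case1: 1
    have "(a - d)\<^sup>2 + (b + c)\<^sup>2 = (a * a + b * b) + (c * c + d * d) - 2 * (a * d - b * c)"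
      by (simp add: power2_eq_square algebra_simps)
    then have "(a - d)\<^sup>2 + (b + c)\<^sup>2 = 0" using rows2 case1 by simp
    then have "a = d" "b = - c" by (auto simp: sum_power2_eq_zero_iff)
    then show ?thesis
      unfolding commute_biv_iff forall_6
      by (simp add: partner_def plane_def orient_def z abcd)
  next
    case case2: 2
    have "(a + d)\<^sup>2 + (b - c)\<^sup>2 = (a * a + b * b) + (c * c + d * d) + 2 * (a * d - b * c)"
      by (simp add: power2_eq_square algebra_simps)
    then have "(a + d)\<^sup>2 + (b - c)\<^sup>2 = 0" using rows2 case2 by simp
    then have da: "d = - a" "c = b" by (auto simp: sum_power2_eq_zero_iff)
    define k where "k = g ** flip6"
    have k_nth: "k $ i $ j = (if j = 6 then - g $ i $ j else g $ i $ j)" for i j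
      by (simp add: k_def flip6_mult_nth)
    have "act flip6 (biv (vector [1, 1, 0])) = biv (vector [1, 1, 0])"
      by (simp add: act_flip6)
    then have flip_comm: "flip6 ** biv (vector [1, 1, 0]) = biv (vector [1, 1, 0]) ** flip6"
      by (simp add: act_fixes_iff_commute[OF flip6_orthogonal])
    have "k ** biv (vector [1, 1, 0]) = g ** (flip6 ** biv (vector [1, 1, 0]))"
      by (simp add: k_def matrix_mul_assoc)
    also have "\<dots> = (g ** biv (vector [1, 1, 0])) ** flip6"
      by (simp add: flip_comm matrix_mul_assoc)
    also have "\<dots> = biv (vector [1, 1, 0]) ** k"
      unfolding comm by (simp add: k_def matrix_mul_assoc)
    finally have "k ** biv (vector [1, 1, 0]) = biv (vector [1, 1, 0]) ** k" .
    moreover have "k ** biv (vector [0, 0, 1]) = biv (vector [0, 0, 1]) ** k"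
      unfolding commute_biv_iff forall_6
      by (simp add: partner_def plane_def orient_def z k_nth abcd da)
    moreover have "(vector [1, 1, 1] :: real^3) = vector [1, 1, 0] + vector [0, 0, 1]"
      by (simp add: Finite_Cartesian_Product.vec_eq_iff forall_3)
    ultimately have "k ** biv (vector [1, 1, 1]) = biv (vector [1, 1, 1]) ** k"
      by (simp add: biv_add matrix_add_ldistrib matrix_add_rdistrib)
    then have "det k = 1"
      using og flip6_orthogonal by (intro det_commuting_biv_ones) (auto simp: k_def orthogonal_matrix_mul)
    then show ?thesis using dg det_flip6 by (simp add: k_def det_mul)
  qed
qed

section \<open>Isotropy groups of bivectors\<close>

definition in_chamber :: "real^3 \<Rightarrow> bool" where
  "in_chamber l \<longleftrightarrow> l $ 1 \<ge> l $ 2 \<and> l $ 2 \<ge> \<bar>l $ 3\<bar>"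

lemma inner_simple_roots:
  fixes x :: "real^3"
  shows "x \<bullet> vector [1, - 1, 0] = x $ 1 - x $ 2" and "x \<bullet> vector [0, 1, - 1] = x $ 2 - x $ 3"
    and "x \<bullet> vector [0, 1, 1] = x $ 2 + x $ 3"
  unfolding inner_vec_def sum_3 vector_3 inner_real_def by simp_all

lemma simple_roots_mem:
  "vector [1, - 1, 0] \<in> simple_roots" "vector [0, 1, - 1] \<in> simple_roots" "vector [0, 1, 1] \<in> simple_roots"
  unfolding simple_roots_def by blast+

text \<open>
In the chamber, the walls containing \<open>l\<close> decide all equations \<open>l\<^sub>a = \<plusminus> l\<^sub>b\<close> with \<open>a \<noteq> b\<close>, and also
whether \<open>l\<^sub>1\<close> and \<open>l\<^sub>2\<close> vanish.  Only \<open>l\<^sub>3 = 0\<close> with \<open>l\<^sub>2 > 0\<close> escapes them; there the part of \<open>m\<close> in the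
first two planes is handled as before and the third plane separately.
\<close>

lemma isotropy_biv_mono:
  assumes l: "in_chamber l" and m: "in_chamber m"
    and walls: "\<And>\<alpha>. \<alpha> \<in> simple_roots \<Longrightarrow> l \<bullet> \<alpha> = 0 \<longleftrightarrow> m \<bullet> \<alpha> = 0"
  shows "isotropy (biv l) \<subseteq> isotropy (biv m)"
proof
  have w: "l $ 1 - l $ 2 = 0 \<longleftrightarrow> m $ 1 - m $ 2 = 0" "l $ 2 - l $ 3 = 0 \<longleftrightarrow> m $ 2 - m $ 3 = 0"
      "l $ 2 + l $ 3 = 0 \<longleftrightarrow> m $ 2 + m $ 3 = 0"
    using simple_roots_mem[THEN walls] unfolding inner_simple_roots .
  note ord = l[unfolded in_chamber_def] m[unfolded in_chamber_def]
  fix g assume "g \<in> isotropy (biv l)"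
  then have g: "g \<in> SO6" and comm: "g ** biv l = biv l ** g" by (auto simp: isotropy_iff)
  have "g ** biv m = biv m ** g"
  proof (cases "l $ 3 = 0 \<and> l $ 2 \<noteq> 0")
    case False
    have "\<forall>a b. (l $ a = l $ b \<longrightarrow> m $ a = m $ b) \<and> (l $ a = - l $ b \<longrightarrow> m $ a = - m $ b)"
      unfolding forall_3 using w ord False by smt
    with comm show ?thesis by (intro commute_biv_transfer[OF comm]) blast+
  next
    case True
    define m' :: "real^3" where "m' = vector [m $ 1, m $ 2, 0]"
    have "\<forall>a b. (l $ a = l $ b \<longrightarrow> m' $ a = m' $ b) \<and> (l $ a = - l $ b \<longrightarrow> m' $ a = - m' $ b)"
      unfolding forall_3 m'_def vector_3 using w ord True by smt
    then have 1: "g ** biv m' = biv m' ** g" by (intro commute_biv_transfer[OF comm]) blast+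
    define n :: "real^3" where "n = vector [1, 1, 0]"
    have "\<forall>a b. (l $ a = l $ b \<longrightarrow> n $ a = n $ b) \<and> (l $ a = - l $ b \<longrightarrow> n $ a = - n $ b)"
      unfolding forall_3 n_def vector_3 using w ord True by smt
    then have "g ** biv n = biv n ** g" by (intro commute_biv_transfer[OF comm]) blast+
    then have 2: "g ** biv (vector [0, 0, 1]) = biv (vector [0, 0, 1]) ** g"
      using SO6_commute_third_plane[OF g] by (simp add: n_def)
    have "m = m' + m $ 3 *\<^sub>R vector [0, 0, 1]"
      by (simp add: m'_def Finite_Cartesian_Product.vec_eq_iff forall_3)
    then have "biv m = biv m' + m $ 3 *\<^sub>R biv (vector [0, 0, 1])"
      by (metis biv_add biv_scaleR)
    then show ?thesis
      by (simp add: matrix_add_ldistrib matrix_add_rdistrib 1 2 matrix_scalar_ac flip: scalar_matrix_assoc)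
  qed
  with g show "g \<in> isotropy (biv m)" by (simp add: isotropy_iff)
qed

lemma isotropy_biv_eq:
  assumes "in_chamber l" "in_chamber m"
    and "\<And>\<alpha>. \<alpha> \<in> simple_roots \<Longrightarrow> l \<bullet> \<alpha> = 0 \<longleftrightarrow> m \<bullet> \<alpha> = 0"
  shows "isotropy (biv l) = isotropy (biv m)"
  by (rule equalityI[OF isotropy_biv_mono[OF assms] isotropy_biv_mono[OF assms(2,1) assms(3)[symmetric]]])

lemma act_wedge: "act g (wedge u v) = wedge (g *v u) (g *v v)"
proof -
  have "act g (wedge u v) $ i $ j = wedge (g *v u) (g *v v) $ i $ j" for i j
  proof -
    have "act g (wedge u v) $ i $ j = (\<Sum>k\<in>UNIV. \<Sum>n\<in>UNIV. g $ i $ n * (u $ n * v $ k - v $ n * u $ k) * g $ j $ k)"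
      by (simp add: act_def wedge_def matrix_matrix_mult_def transpose_def sum_distrib_right)
    also have "\<dots> = (\<Sum>k\<in>UNIV. \<Sum>n\<in>UNIV. (g $ j $ k * v $ k) * (g $ i $ n * u $ n))
        - (\<Sum>k\<in>UNIV. \<Sum>n\<in>UNIV. (g $ j $ k * u $ k) * (g $ i $ n * v $ n))"
      by (simp add: algebra_simps flip: sum_subtractf)
    also have "\<dots> = wedge (g *v u) (g *v v) $ i $ j"
      by (simp add: wedge_def matrix_vector_mult_def flip: sum_product)
    finally show ?thesis .
  qed
  then show ?thesis by (simp add: Finite_Cartesian_Product.vec_eq_iff)
qed

lemma wedge_mult_vec: "wedge u v *v x = (v \<bullet> x) *\<^sub>R u - (u \<bullet> x) *\<^sub>R v"
  by (simp add: Finite_Cartesian_Product.vec_eq_iff matrix_vector_mult_def wedge_def inner_vec_def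
      algebra_simps sum_subtractf sum_distrib_left)

text \<open>
If \<open>g\<close> commutes with \<open>W = e\<^sub>i \<and> e\<^sub>j\<close>, which maps \<open>e\<^sub>j\<close> to \<open>e\<^sub>i\<close>, then \<open>g e\<^sub>i = g W e\<^sub>j = W g e\<^sub>j\<close> lies in the plane
of the two axes, and its coordinates there are a cosine and a sine since \<open>g\<close> is an isometry.
\<close>

lemma rotates_iff_fixes_wedge:
  assumes g: "orthogonal_matrix g" and "i \<noteq> j"
  shows "rotates i j g \<longleftrightarrow> act g (wedge (axis i 1) (axis j 1)) = wedge (axis i 1) (axis j 1)"
proof
  let ?e = "axis i 1 :: real^6" and ?f = "axis j 1 :: real^6"
  assume "rotates i j g"
  then obtain \<theta> where "g *v ?e = cos \<theta> *\<^sub>R ?e + sin \<theta> *\<^sub>R ?f" "g *v ?f = - sin \<theta> *\<^sub>R ?e + cos \<theta> *\<^sub>R ?f"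
    by (auto simp: rotates_def)
  moreover have "wedge (c *\<^sub>R ?e + s *\<^sub>R ?f) (- s *\<^sub>R ?e + c *\<^sub>R ?f) = (c\<^sup>2 + s\<^sup>2) *\<^sub>R wedge ?e ?f" for c s
    by (simp add: wedge_def Finite_Cartesian_Product.vec_eq_iff algebra_simps power2_eq_square)
  ultimately show "act g (wedge ?e ?f) = wedge ?e ?f"
    by (simp add: act_wedge)
next
  let ?e = "axis i 1 :: real^6" and ?f = "axis j 1 :: real^6"
  let ?W = "wedge ?e ?f"
  assume "act g ?W = ?W"
  then have comm: "g ** ?W = ?W ** g" using act_fixes_iff_commute[OF g] by simp
  have W: "?W *v x = x $ j *\<^sub>R ?e - x $ i *\<^sub>R ?f" for x
    by (simp add: wedge_mult_vec inner_axis')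
  have coords: "?e $ i = 1" "?e $ j = 0" "?f $ i = 0" "?f $ j = 1"
    using \<open>i \<noteq> j\<close> by (simp_all add: axis_def)
  have We: "?W *v ?e = - ?f" and Wf: "?W *v ?f = ?e"
    by (simp_all add: W coords)
  define a b where "a = (g *v ?f) $ j" and "b = - (g *v ?f) $ i"
  have ge: "g *v ?e = a *\<^sub>R ?e + b *\<^sub>R ?f"
  proof -
    have "g *v ?e = ?W *v (g *v ?f)"
      by (metis Wf comm matrix_vector_mul_assoc)
    then show ?thesis by (simp add: W a_def b_def)
  qed
  have gf: "g *v ?f = - b *\<^sub>R ?e + a *\<^sub>R ?f"
  proof -
    have "g *v (- ?f) = ?W *v (g *v ?e)"
      by (metis We comm matrix_vector_mul_assoc)
    then have "- (g *v ?f) = ?W *v (g *v ?e)" by (simp add: matrix_vector_mult_uminus)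
    also have "\<dots> = b *\<^sub>R ?e - a *\<^sub>R ?f"
      unfolding W ge by (simp add: coords)
    finally show ?thesis by (simp add: minus_equation_iff[of "g *v ?f"])
  qed
  have "(g *v ?e) \<bullet> (g *v ?e) = ?e \<bullet> ?e"
    using g by (simp add: inner_matrix_transpose matrix_vector_mul_assoc orthogonal_matrix_def)
  then have "a\<^sup>2 + b\<^sup>2 = 1"
    unfolding ge using \<open>i \<noteq> j\<close>
    by (simp add: inner_add_left inner_add_right inner_axis_axis power2_eq_square)
  then obtain \<theta> where "a = cos \<theta>" "b = sin \<theta>" using sincos_total_2pi by metis
  with ge gf show "rotates i j g" by (auto simp: rotates_def)
qed

lemma biv_axes:
  "wedge (axis 1 1) (axis 2 1) = biv (vector [1, 0, 0])"
  "wedge (axis 3 1) (axis 4 1) = biv (vector [0, 1, 0])"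
  "wedge (axis 5 1) (axis 6 1) = biv (vector [0, 0, 1])"
  by (simp_all add: biv_def)

lemma rotates_iff_isotropy:
  assumes "g \<in> SO6"
  shows "rotates 1 2 g \<longleftrightarrow> g \<in> isotropy (biv (vector [1, 0, 0]))"
    and "rotates 3 4 g \<longleftrightarrow> g \<in> isotropy (biv (vector [0, 1, 0]))"
    and "rotates 5 6 g \<longleftrightarrow> g \<in> isotropy (biv (vector [0, 0, 1]))"
  using assms rotates_iff_fixes_wedge[OF SO6_orthogonal[OF assms]]
  by (simp_all add: isotropy_def biv_axes)

lemma isotropy_biv_scaleR: "g \<in> isotropy (biv x) \<Longrightarrow> g \<in> isotropy (biv (c *\<^sub>R x))"
  and isotropy_biv_add: "g \<in> isotropy (biv x) \<Longrightarrow> g \<in> isotropy (biv y) \<Longrightarrow> g \<in> isotropy (biv (x + y))"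
  and isotropy_biv_diff: "g \<in> isotropy (biv x) \<Longrightarrow> g \<in> isotropy (biv y) \<Longrightarrow> g \<in> isotropy (biv (x - y))"
  by (simp_all add: isotropy_def biv_scaleR biv_add biv_diff act_scaleR act_add act_diff)

lemma vec3_eqI: "x $ 1 = y $ 1 \<Longrightarrow> x $ 2 = y $ 2 \<Longrightarrow> x $ 3 = y $ 3 \<Longrightarrow> x = (y :: 'a^3)"
  by (simp add: Finite_Cartesian_Product.vec_eq_iff forall_3)

lemma isotropy_vector_mono:
  assumes "g \<in> isotropy (biv (vector [a, b, c]))"
    and "a \<ge> b" "b \<ge> \<bar>c\<bar>" "a' \<ge> b'" "b' \<ge> \<bar>c'\<bar>"
    and "a = b \<longleftrightarrow> a' = b'" "b = c \<longleftrightarrow> b' = c'" "b = - c \<longleftrightarrow> b' = - c'"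
  shows "g \<in> isotropy (biv (vector [a', b', c']))"
proof -
  have "isotropy (biv (vector [a, b, c])) \<subseteq> isotropy (biv (vector [a', b', c']))"
    using assms(2-) by (intro isotropy_biv_mono)
      (auto simp: in_chamber_def simple_roots_def inner_simple_roots)
  with assms(1) show ?thesis by blast
qed

text \<open>
The bivector must be in the open chamber; with \<open>l\<^sub>3 = 0\<close> the inclusion of \<open>T3\<close> is a matter of two
planes only.  Conversely the isotropy group fixes \<open>biv\<close> on the whole open chamber, and differences
of points of the chamber give all three coordinate bivectors.
\<close>

lemma T3_isotropy: "T3 = isotropy (biv (vector [3, 2, 0]))"
proof
  show "T3 \<subseteq> isotropy (biv (vector [3, 2, 0]))"
  proof
    fix g assume "g \<in> T3"
    then have "g \<in> isotropy (biv (vector [1, 0, 0]))" "g \<in> isotropy (biv (vector [0, 1, 0]))"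
      using rotates_iff_isotropy by (auto simp: T3_def)
    then have "g \<in> isotropy (biv (3 *\<^sub>R vector [1, 0, 0] + 2 *\<^sub>R vector [0, 1, 0]))"
      by (intro isotropy_biv_add isotropy_biv_scaleR)
    also have "3 *\<^sub>R vector [1, 0, 0] + 2 *\<^sub>R vector [0, 1, 0] = (vector [3, 2, 0] :: real^3)"
      by (rule vec3_eqI) simp_all
    finally show "g \<in> isotropy (biv (vector [3, 2, 0]))" .
  qed
  show "isotropy (biv (vector [3, 2, 0])) \<subseteq> T3"
  proof
    fix g assume g: "g \<in> isotropy (biv (vector [3, 2, 0]))"
    have g1: "g \<in> isotropy (biv (vector [4, 2, 0]))" and g2: "g \<in> isotropy (biv (vector [4, 3, 0]))"
      and g3: "g \<in> isotropy (biv (vector [3, 2, 1]))"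
      by (rule isotropy_vector_mono[OF g]; simp)+
    have "(vector [1, 0, 0] :: real^3) = vector [4, 2, 0] - vector [3, 2, 0]"
      "(vector [0, 1, 0] :: real^3) = vector [4, 3, 0] - vector [4, 2, 0]"
      "(vector [0, 0, 1] :: real^3) = vector [3, 2, 1] - vector [3, 2, 0]"
      by (rule vec3_eqI; simp)+
    then have "g \<in> isotropy (biv (vector [1, 0, 0]))" "g \<in> isotropy (biv (vector [0, 1, 0]))"
      "g \<in> isotropy (biv (vector [0, 0, 1]))"
      using g g1 g2 g3 isotropy_biv_diff by auto
    moreover have "g \<in> SO6" using g by (simp add: isotropy_def)
    ultimately show "g \<in> T3" by (simp add: T3_def rotates_iff_isotropy)
  qed
qed

lemma U2_SO2_isotropy: "U2_SO2 = isotropy (biv (vector [2, 2, 0]))"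
proof
  have two: "2 *\<^sub>R vector [1, 1, 0] = (vector [2, 2, 0] :: real^3)" by (rule vec3_eqI) simp_all
  show "U2_SO2 \<subseteq> isotropy (biv (vector [2, 2, 0]))"
    using isotropy_biv_scaleR[where x = "vector [1, 1, 0]" and c = 2] unfolding two
    by (auto simp: U2_SO2_def isotropy_iff)
  show "isotropy (biv (vector [2, 2, 0])) \<subseteq> U2_SO2"
  proof
    fix g assume g: "g \<in> isotropy (biv (vector [2, 2, 0]))"
    have g1: "g \<in> isotropy (biv (vector [1, 1, 0]))" and g2: "g \<in> isotropy (biv (vector [2, 2, 1]))"
      by (rule isotropy_vector_mono[OF g]; simp)+
    have "(vector [0, 0, 1] :: real^3) = vector [2, 2, 1] - vector [2, 2, 0]"
      by (rule vec3_eqI; simp)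
    then have "g \<in> isotropy (biv (vector [0, 0, 1]))" using g g2 isotropy_biv_diff by auto
    moreover have "g \<in> SO6" using g by (simp add: isotropy_def)
    ultimately show "g \<in> U2_SO2" using g1 by (simp add: U2_SO2_def rotates_iff_isotropy isotropy_iff)
  qed
qed

lemma U3_isotropy: "U3 = isotropy (biv (vector [1, 1, 1]))"
  by (auto simp: U3_def isotropy_iff)

lemma SO2_SO4_isotropy: "SO2_SO4 = isotropy (biv (vector [1, 0, 0]))"
proof -
  have "g \<in> SO2_SO4 \<longleftrightarrow> g \<in> isotropy (biv (vector [1, 0, 0]))" for g
    using rotates_iff_isotropy(1)[of g] unfolding SO2_SO4_def isotropy_def by blast
  then show ?thesis by blast
qed

section \<open>Simple reflections in the Weyl group\<close>

lemma reflection_simple_roots: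
  "reflection (vector [1, - 1, 0]) x = vector [x $ 2, x $ 1, x $ 3]"
  "reflection (vector [0, 1, - 1]) x = vector [x $ 1, x $ 3, x $ 2]"
  "reflection (vector [0, 1, 1]) x = vector [x $ 1, - x $ 3, - x $ 2]"
  by (rule vec3_eqI; simp add: reflection_def inner_simple_roots field_simps)+

text \<open>
The matrix of a permutation of the axes.  The three simple reflections are realised by involutions
that permute the coordinate planes.
\<close>

definition involution_mat :: "(6 \<Rightarrow> 6) \<Rightarrow> real^6^6" where
  "involution_mat \<pi> = (\<chi> i j. if i = \<pi> j then 1 else 0)"

context
  fixes \<pi> :: "6 \<Rightarrow> 6"
  assumes invol: "\<And>i. \<pi> (\<pi> i) = i" and planes: "\<And>i. \<pi> (partner i) = partner (\<pi> i)"
begin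

lemma involution_swap: "i = \<pi> k \<longleftrightarrow> k = \<pi> i"
  by (metis invol)

lemma involution_mat_mult_nth:
  "(involution_mat \<pi> ** A) $ i $ j = A $ \<pi> i $ j" "(A ** involution_mat \<pi>) $ i $ j = A $ i $ \<pi> j"
proof -
  have "(involution_mat \<pi> ** A) $ i $ j = (\<Sum>k\<in>UNIV. if k = \<pi> i then A $ k $ j else 0)"
    by (simp add: involution_mat_def matrix_matrix_mult_def involution_swap[of i] if_distrib[of "\<lambda>a. a * _"] cong: if_cong)
  then show "(involution_mat \<pi> ** A) $ i $ j = A $ \<pi> i $ j" by simp
  show "(A ** involution_mat \<pi>) $ i $ j = A $ i $ \<pi> j"
    by (simp add: involution_mat_def matrix_matrix_mult_def if_distrib[of "\<lambda>a. _ * a"] cong: if_cong)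
qed

lemma involution_mat_orthogonal: "orthogonal_matrix (involution_mat \<pi>)"
proof -
  have "transpose (involution_mat \<pi>) = involution_mat \<pi>"
    by (simp add: transpose_def involution_mat_def Finite_Cartesian_Product.vec_eq_iff involution_swap)
  moreover have "involution_mat \<pi> ** involution_mat \<pi> = mat 1"
    by (simp add: Finite_Cartesian_Product.vec_eq_iff involution_mat_mult_nth)
      (simp add: involution_mat_def Finite_Cartesian_Product.mat_def involution_swap invol)
  ultimately show ?thesis by (simp add: orthogonal_matrix_def)
qed

lemma act_involution_mat:
  assumes "\<And>i. orient (\<pi> i) * x $ plane (\<pi> i) = orient i * y $ plane i"
  shows "act (involution_mat \<pi>) (biv x) = biv y"
proof -
  have "involution_mat \<pi> ** transpose (involution_mat \<pi>) = mat 1"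
    using involution_mat_orthogonal by (simp add: orthogonal_matrix_def)
  moreover have "involution_mat \<pi> ** biv x = biv y ** involution_mat \<pi>"
  proof -
    have "\<pi> j = partner i \<longleftrightarrow> j = partner (\<pi> i)" for i j
      by (metis invol planes)
    then show ?thesis
      by (simp add: Finite_Cartesian_Product.vec_eq_iff involution_mat_mult_nth biv_nth assms)
  qed
  ultimately show ?thesis by (simp add: act_def flip: matrix_mul_assoc)
qed

lemma involution_mat_SO6:
  assumes "\<And>i. orient (\<pi> i) * l $ plane (\<pi> i) = orient i * l $ plane i" and "\<And>a. l $ a * l $ a = 1"
  shows "involution_mat \<pi> \<in> SO6"
  using det_commuting_biv[OF involution_mat_orthogonal _ assms(2)] act_involution_mat[OF assms(1)]
    act_fixes_iff_commute[OF involution_mat_orthogonal] involution_mat_orthogonal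
  by (simp add: SO6_def rotation_matrix_def)

end

text \<open>
The simple reflections exchange two coordinate planes, the last one after reversing the
orientation of both.  Each fixes a vector with entries \<open>\<plusminus> 1\<close>, so the corresponding
permutation matrix commutes with a complex structure and has determinant 1.
\<close>

lemma reflection_in_weyl:
  assumes "\<alpha> \<in> simple_roots"
  shows "reflection \<alpha> \<in> weyl SO6"
proof -
  have main: "w \<in> weyl SO6"
    if "\<And>i. \<pi> (\<pi> i) = i" "\<And>i. \<pi> (partner i) = partner (\<pi> i)"
      "\<And>i. orient (\<pi> i) * l $ plane (\<pi> i) = orient i * l $ plane i" "\<And>a. l $ a * l $ a = 1"
      "\<And>x i. orient (\<pi> i) * x $ plane (\<pi> i) = orient i * w x $ plane i" for \<pi> l w
    unfolding weyl_def using involution_mat_SO6[OF that(1-4)] act_involution_mat[OF that(1,2,5)] by blast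
  note defs = partner_def orient_def plane_def reflection_simple_roots
  consider "\<alpha> = vector [1, - 1, 0]" | "\<alpha> = vector [0, 1, - 1]" | "\<alpha> = vector [0, 1, 1]"
    using assms unfolding simple_roots_def by blast
  then show ?thesis
  proof cases
    case 1
    let ?\<pi> = "\<lambda>i :: 6. if i = 1 then 3 else if i = 3 then 1 else if i = 2 then 4 else if i = 4 then 2 else i"
    have "?\<pi> (?\<pi> i) = i \<and> ?\<pi> (partner i) = partner (?\<pi> i) \<and>
        orient (?\<pi> i) * vector [1, 1, 1] $ plane (?\<pi> i) = orient i * vector [1, 1, 1] $ plane i \<and>
        orient (?\<pi> i) * x $ plane (?\<pi> i) = orient i * reflection \<alpha> x $ plane i" for i x
      using exhaust_6[of i] by (elim disjE; simp add: defs 1)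
    moreover have "vector [1, 1, 1] $ a * vector [1, 1, 1] $ a = (1 :: real)" for a :: 3
      using exhaust_3[of a] by (elim disjE; simp)
    ultimately show ?thesis by (intro main[of ?\<pi> "vector [1, 1, 1]"]) blast+
  next
    case 2
    let ?\<pi> = "\<lambda>i :: 6. if i = 3 then 5 else if i = 5 then 3 else if i = 4 then 6 else if i = 6 then 4 else i"
    have "?\<pi> (?\<pi> i) = i \<and> ?\<pi> (partner i) = partner (?\<pi> i) \<and>
        orient (?\<pi> i) * vector [1, 1, 1] $ plane (?\<pi> i) = orient i * vector [1, 1, 1] $ plane i \<and>
        orient (?\<pi> i) * x $ plane (?\<pi> i) = orient i * reflection \<alpha> x $ plane i" for i x
      using exhaust_6[of i] by (elim disjE; simp add: defs 2)
    moreover have "vector [1, 1, 1] $ a * vector [1, 1, 1] $ a = (1 :: real)" for a :: 3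
      using exhaust_3[of a] by (elim disjE; simp)
    ultimately show ?thesis by (intro main[of ?\<pi> "vector [1, 1, 1]"]) blast+
  next
    case 3
    let ?\<pi> = "\<lambda>i :: 6. if i = 3 then 6 else if i = 6 then 3 else if i = 4 then 5 else if i = 5 then 4 else i"
    have "?\<pi> (?\<pi> i) = i \<and> ?\<pi> (partner i) = partner (?\<pi> i) \<and>
        orient (?\<pi> i) * vector [1, 1, - 1] $ plane (?\<pi> i) = orient i * vector [1, 1, - 1] $ plane i \<and>
        orient (?\<pi> i) * x $ plane (?\<pi> i) = orient i * reflection \<alpha> x $ plane i" for i x
      using exhaust_6[of i] by (elim disjE; simp add: defs 3)
    moreover have "vector [1, 1, - 1] $ a * vector [1, 1, - 1] $ a = (1 :: real)" for a :: 3
      using exhaust_3[of a] by (elim disjE; simp)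
    ultimately show ?thesis by (intro main[of ?\<pi> "vector [1, 1, - 1]"]) blast+
  qed
qed

lemma id_in_weyl: "id \<in> weyl SO6"
proof -
  have "mat 1 \<in> SO6" by (simp add: SO6_def rotation_matrix_def orthogonal_matrix_id)
  then show ?thesis by (auto simp: weyl_def act_id intro!: bexI[of _ "mat 1"])
qed

lemma SO6_mult: "g \<in> SO6 \<Longrightarrow> h \<in> SO6 \<Longrightarrow> g ** h \<in> SO6"
  by (simp add: SO6_def rotation_matrix_def orthogonal_matrix_mul det_mul)

lemma comp_in_weyl:
  assumes "v \<in> weyl SO6" "w \<in> weyl SO6" shows "v \<circ> w \<in> weyl SO6"
proof -
  obtain g h where "g \<in> SO6" "\<And>x. act g (biv x) = biv (v x)" "h \<in> SO6" "\<And>x. act h (biv x) = biv (w x)"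
    using assms by (auto simp: weyl_def)
  then show ?thesis
    unfolding weyl_def by (auto intro!: bexI[of _ "g ** h"] SO6_mult simp flip: act_compose)
qed

section \<open>Lengths of signed permutations\<close>

text \<open>
The code of a signed permutation \<open>w\<close> is the point \<open>w (3,2,1)\<close>.  The entry \<open>\<plusminus> 3\<close> marks the place to
which the first coordinate goes, \<open>\<plusminus> 2\<close> the second and \<open>\<plusminus> 1\<close> the third.
\<close>

type_synonym code = "int \<times> int \<times> int"

fun code_vec :: "code \<Rightarrow> real^3" where
  "code_vec (a, b, c) = vector [of_int a, of_int b, of_int c]"

definition entry :: "int \<Rightarrow> real^3 \<Rightarrow> real" where
  "entry v x = of_int (sgn v) * (if \<bar>v\<bar> = 3 then x $ 1 else if \<bar>v\<bar> = 2 then x $ 2 else x $ 3)"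

fun signed_perm :: "code \<Rightarrow> real^3 \<Rightarrow> real^3" where
  "signed_perm (a, b, c) x = vector [entry a x, entry b x, entry c x]"

text \<open>
The integer version of \<open>entry\<close>, so that composition of signed permutations can be computed on
codes.
\<close>

fun int_entry :: "int \<Rightarrow> code \<Rightarrow> int" where
  "int_entry v (x, y, z) = sgn v * (if \<bar>v\<bar> = 3 then x else if \<bar>v\<bar> = 2 then y else z)"

fun code_comp :: "code \<Rightarrow> code \<Rightarrow> code" where
  "code_comp (a, b, c) t = (int_entry a t, int_entry b t, int_entry c t)"

text \<open>
The product of the entries is positive iff the number of sign changes is even.
\<close>

definition weyl_codes :: "code list" where
  "weyl_codes = filter (\<lambda>(a, b, c). \<bar>a\<bar> \<noteq> \<bar>b\<bar> \<and> \<bar>a\<bar> \<noteq> \<bar>c\<bar> \<and> \<bar>b\<bar> \<noteq> \<bar>c\<bar> \<and> a * b * c > 0)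
     (List.product [-3, -2, -1, 1, 2, 3] (List.product [-3, -2, -1, 1, 2, 3] [-3, -2, -1, 1, 2, 3]))"

text \<open>
The number of positive roots of type \<open>D\<^sub>3\<close> that are negative on the code.
\<close>

fun inversions :: "code \<Rightarrow> nat" where
  "inversions (a, b, c) = length (filter (\<lambda>r. r < 0) [a - b, a - c, b - c, a + b, a + c, b + c])"

text \<open>
The three simple reflections act on the values of a signed permutation, hence on the places of its
code.
\<close>

fun simple_moves :: "code \<Rightarrow> code list" where
  "simple_moves (a, b, c) = [(b, a, c), (a, c, b), (a, - c, - b)]"

lemma simple_moves_step:
  "list_all (\<lambda>p. list_all (\<lambda>q. q \<in> set weyl_codes \<and> inversions q \<le> Suc (inversions p)) (simple_moves p)) weyl_codes"
  by code_simp

lemma simple_moves_descend: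
  "list_all (\<lambda>p. p = (3, 2, 1) \<or> list_ex (\<lambda>q. inversions q < inversions p) (simple_moves p)) weyl_codes"
  by code_simp

declare inversions.simps [simp del] simple_moves.simps [simp del]

lemma code_vec_inj: "code_vec s = code_vec t \<longleftrightarrow> s = t"
  by (cases s; cases t) (auto simp: Finite_Cartesian_Product.vec_eq_iff forall_3)

lemma entry_code_vec: "entry v (code_vec t) = of_int (int_entry v t)"
  by (cases t) (simp add: entry_def)

lemma signed_perm_code_vec: "signed_perm p (code_vec t) = code_vec (code_comp p t)"
  by (cases p) (simp add: entry_code_vec)

lemma weyl_codes_base: "p \<in> set weyl_codes \<Longrightarrow> code_comp p (3, 2, 1) = p"
proof -
  have "list_all (\<lambda>p. code_comp p (3, 2, 1) = p) weyl_codes" by code_simp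
  then show "p \<in> set weyl_codes \<Longrightarrow> code_comp p (3, 2, 1) = p" by (simp add: list_all_iff)
qed

text \<open>
A signed permutation is determined by its value at \<open>(3,2,1)\<close>, which is its code.
\<close>

lemma signed_perm_inj: "p \<in> set weyl_codes \<Longrightarrow> q \<in> set weyl_codes \<Longrightarrow> signed_perm p = signed_perm q \<longleftrightarrow> p = q"
  by (metis weyl_codes_base code_vec_inj signed_perm_code_vec)

lemma base_code: "(3, 2, 1) \<in> set weyl_codes"
  by code_simp

lemma signed_perm_base: "signed_perm (3, 2, 1) = id"
  by (rule ext, rule vec3_eqI) (simp_all add: entry_def)

lemma reflection_signed_perm:
  "(\<lambda>\<alpha>. reflection \<alpha> \<circ> signed_perm p) ` simple_roots = signed_perm ` set (simple_moves p)"
proof -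
  obtain a b c where p: "p = (a, b, c)" by (cases p)
  have minus: "entry (- v) x = - entry v x" for v x by (simp add: entry_def)
  have "reflection (vector [1, - 1, 0]) \<circ> signed_perm p = signed_perm (b, a, c)"
    "reflection (vector [0, 1, - 1]) \<circ> signed_perm p = signed_perm (a, c, b)"
    "reflection (vector [0, 1, 1]) \<circ> signed_perm p = signed_perm (a, - c, - b)"
    by (simp_all add: p fun_eq_iff reflection_simple_roots minus)
  then show ?thesis by (simp add: simple_roots_def p simple_moves.simps)
qed

lemma reflection_involution: "\<alpha> \<in> simple_roots \<Longrightarrow> reflection \<alpha> (reflection \<alpha> x) = x"
  unfolding simple_roots_def by (auto simp: reflection_simple_roots intro!: vec3_eqI)

abbreviation word_action :: "(real^3) list \<Rightarrow> real^3 \<Rightarrow> real^3" where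
  "word_action \<alpha>s \<equiv> foldr (\<lambda>\<alpha> v. reflection \<alpha> \<circ> v) \<alpha>s id"

lemma word_action_code:
  assumes "set \<alpha>s \<subseteq> simple_roots"
  shows "\<exists>p\<in>set weyl_codes. word_action \<alpha>s = signed_perm p \<and> inversions p \<le> length \<alpha>s"
  using assms
proof (induction \<alpha>s)
  case Nil
  have "word_action [] = signed_perm (3, 2, 1)" by (simp add: signed_perm_base)
  moreover have "inversions (3, 2, 1) \<le> length []" by (simp add: inversions.simps)
  ultimately show ?case using base_code by blast
next
  case (Cons \<alpha> \<alpha>s)
  then have "set \<alpha>s \<subseteq> simple_roots" by simp
  then obtain p where p: "p \<in> set weyl_codes" "word_action \<alpha>s = signed_perm p" "inversions p \<le> length \<alpha>s"
    using Cons.IH by blast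
  have "reflection \<alpha> \<circ> signed_perm p \<in> signed_perm ` set (simple_moves p)"
    using reflection_signed_perm[of p] Cons.prems by auto
  then obtain q where q: "q \<in> set (simple_moves p)" "reflection \<alpha> \<circ> signed_perm p = signed_perm q" by blast
  have "word_action (\<alpha> # \<alpha>s) = signed_perm q"
    by (simp only: foldr_Cons o_apply p(2) q(2))
  moreover have "q \<in> set weyl_codes" "inversions q \<le> Suc (inversions p)"
    using simple_moves_step p(1) q(1) unfolding list_all_iff by blast+
  moreover have "length (\<alpha> # \<alpha>s) = Suc (length \<alpha>s)" by simp
  ultimately show ?case using p(3) by (metis Suc_le_mono le_trans)
qed

lemma code_word_action:
  assumes "p \<in> set weyl_codes"
  shows "\<exists>\<alpha>s. set \<alpha>s \<subseteq> simple_roots \<and> length \<alpha>s \<le> inversions p \<and> word_action \<alpha>s = signed_perm p"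
  using assms
proof (induction "inversions p" arbitrary: p rule: less_induct)
  case less
  show ?case
  proof (cases "p = (3, 2, 1)")
    case True
    then show ?thesis by (intro exI[of _ "[]"]) (simp add: signed_perm_base)
  next
    case False
    then obtain q where q: "q \<in> set (simple_moves p)" "inversions q < inversions p"
      using simple_moves_descend less.prems unfolding list_all_iff list_ex_iff by blast
    then have "q \<in> set weyl_codes" using simple_moves_step less.prems unfolding list_all_iff by blast
    then obtain \<alpha>s where as: "set \<alpha>s \<subseteq> simple_roots" "length \<alpha>s \<le> inversions q" "word_action \<alpha>s = signed_perm q"
      using less.hyps q(2) by blast
    obtain \<alpha> where \<alpha>: "\<alpha> \<in> simple_roots" "signed_perm q = reflection \<alpha> \<circ> signed_perm p"
      using reflection_signed_perm[of p] q(1) by blast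
    have "reflection \<alpha> \<circ> signed_perm q = signed_perm p"
      using reflection_involution[OF \<alpha>(1)] by (simp add: \<alpha>(2) fun_eq_iff)
    then have "word_action (\<alpha> # \<alpha>s) = signed_perm p"
      by (simp only: foldr_Cons o_apply as(3))
    moreover have "set (\<alpha> # \<alpha>s) \<subseteq> simple_roots" "length (\<alpha> # \<alpha>s) \<le> inversions p"
      using as \<alpha>(1) q(2) by simp_all
    ultimately show ?thesis by blast
  qed
qed

text \<open>
Each letter of a word raises the number of inversions by at most one, and a word that lowers it in
each step reaches the dominant code \<open>(3,2,1)\<close>, the code of the identity.
\<close>

lemma weyl_length_signed_perm:
  assumes p: "p \<in> set weyl_codes" shows "weyl_length (signed_perm p) = inversions p"
proof -
  obtain \<alpha>s where as: "set \<alpha>s \<subseteq> simple_roots" "length \<alpha>s \<le> inversions p" "word_action \<alpha>s = signed_perm p"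
    using code_word_action[OF p] by blast
  have min: "inversions p \<le> length \<beta>s" if "set \<beta>s \<subseteq> simple_roots" "signed_perm p = word_action \<beta>s" for \<beta>s
    using word_action_code[OF that(1)] that(2) signed_perm_inj[OF p] by metis
  have "length \<alpha>s = inversions p" using min[OF as(1)] as by simp
  then show ?thesis
    unfolding weyl_length_def using as min by (intro Least_equality) metis+
qed

lemma signed_perm_in_weyl:
  assumes "p \<in> set weyl_codes" shows "signed_perm p \<in> weyl SO6"
proof -
  have "set \<alpha>s \<subseteq> simple_roots \<Longrightarrow> word_action \<alpha>s \<in> weyl SO6" for \<alpha>s
  proof (induction \<alpha>s)
    case (Cons \<alpha> \<alpha>s)
    then have "\<alpha> \<in> simple_roots" "set \<alpha>s \<subseteq> simple_roots" by simp_all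
    then have "reflection \<alpha> \<circ> word_action \<alpha>s \<in> weyl SO6"
      using comp_in_weyl[OF reflection_in_weyl Cons.IH] by blast
    then show ?case by (simp only: foldr_Cons comp_def)
  qed (simp only: foldr_Nil id_apply id_in_weyl)
  then show ?thesis using code_word_action[OF assms] by metis
qed

section \<open>The Weyl group of SO(6)\<close>

lemma act_mult:
  assumes "orthogonal_matrix g" shows "act g (A ** B) = act g A ** act g B"
proof -
  have "act g A ** act g B = g ** A ** (transpose g ** g) ** B ** transpose g"
    by (simp only: act_def matrix_mul_assoc)
  also have "\<dots> = g ** A ** B ** transpose g"
    using assms by (simp only: orthogonal_matrix_def matrix_mul_rid)
  finally show ?thesis by (simp only: act_def matrix_mul_assoc)
qed

lemma act_inj:
  assumes "orthogonal_matrix g" shows "act g A = act g B \<longleftrightarrow> A = B"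
proof -
  have "act (transpose g) (act g C) = C" for C
    using assms by (simp add: act_compose orthogonal_matrix_def act_id)
  then show ?thesis by metis
qed

lemma biv_mult_eq_0_iff: "biv x ** biv y = 0 \<longleftrightarrow> (\<forall>a. x $ a * y $ a = 0)"
proof
  assume *: "biv x ** biv y = 0"
  have "x $ plane i * y $ plane i = 0" for i
    using arg_cong[OF *, of "\<lambda>A. A $ i $ i"] biv_mult_nth[of x y i i] by simp
  from this[of 1] this[of 3] this[of 5] show "\<forall>a. x $ a * y $ a = 0"
    unfolding forall_3 plane_def by simp
qed (simp add: Finite_Cartesian_Product.vec_eq_iff biv_mult_nth)

lemma biv_cube_eq_uminus_iff: "biv x ** biv x ** biv x = - biv x \<longleftrightarrow> (\<forall>a. x $ a ^ 3 = x $ a)"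
proof -
  have cube: "(biv x ** biv x ** biv x) $ i $ j = - (x $ plane i ^ 2) * biv x $ i $ j" for i j
  proof -
    have "(biv x ** biv x ** biv x) $ i $ j = (\<Sum>k\<in>UNIV. (biv x ** biv x) $ i $ k * biv x $ k $ j)"
      by (simp add: matrix_matrix_mult_def)
    also have "\<dots> = (\<Sum>k\<in>UNIV. if k = i then - (x $ plane i ^ 2) * biv x $ k $ j else 0)"
      by (intro sum.cong) (auto simp: biv_mult_nth power2_eq_square)
    finally show ?thesis by simp
  qed
  show ?thesis
  proof
    assume *: "biv x ** biv x ** biv x = - biv x"
    have "x $ plane i ^ 3 = x $ plane i" for i
    proof -
      have "- (x $ plane i ^ 2) * biv x $ i $ partner i = - biv x $ i $ partner i"
        using arg_cong[OF *, of "\<lambda>A. A $ i $ partner i"] unfolding cube by simp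
      then show ?thesis by (simp add: biv_nth power2_eq_square power3_eq_cube)
    qed
    from this[of 1] this[of 3] this[of 5] show "\<forall>a. x $ a ^ 3 = x $ a"
      unfolding forall_3 plane_def by simp
  next
    assume *: "\<forall>a. x $ a ^ 3 = x $ a"
    have "(biv x ** biv x ** biv x) $ i $ j = (- biv x) $ i $ j" for i j
      unfolding cube using *[rule_format, of "plane i"]
      by (simp add: biv_nth power2_eq_square power3_eq_cube)
    then show "biv x ** biv x ** biv x = - biv x"
      unfolding Finite_Cartesian_Product.vec_eq_iff by blast
  qed
qed

definition signed_perm_code :: "code \<Rightarrow> bool" where
  "signed_perm_code p \<longleftrightarrow> (case p of (a, b, c) \<Rightarrow> {\<bar>a\<bar>, \<bar>b\<bar>, \<bar>c\<bar>} = {1, 2, 3})"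

text \<open>
The coordinate bivectors have cube equal to their negative and pairwise product zero, and so have
their images \<open>biv (w e\<^sub>k)\<close>.  In terms of the vectors \<open>w e\<^sub>k\<close> this says that the entries are in
\<open>{- 1, 0, 1}\<close> and that the supports are disjoint.  The supports are three nonempty sets of
coordinates, so each consists of one coordinate.
\<close>

lemma normalizer_signed_perm:
  assumes g: "orthogonal_matrix g" and w: "\<And>x. act g (biv x) = biv (w x)"
  shows "\<exists>p. signed_perm_code p \<and> w = signed_perm p"
proof -
  have w_add: "w (x + y) = w x + w y" for x y
    by (simp add: w[symmetric] biv_add act_add flip: biv_inj)
  have w_scale: "w (c *\<^sub>R x) = c *\<^sub>R w x" for c x
    by (simp add: w[symmetric] biv_scaleR act_scaleR flip: biv_inj)
  define A where "A k = w (axis k 1)" for k :: 3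
  have w_expand: "w x $ i = (\<Sum>k\<in>UNIV. x $ k * A k $ i)" for x i
  proof -
    have "x = x $ 1 *\<^sub>R axis 1 1 + x $ 2 *\<^sub>R axis 2 1 + x $ 3 *\<^sub>R axis 3 1"
      by (rule vec3_eqI) (simp_all add: axis_def)
    then have "w x = w (x $ 1 *\<^sub>R axis 1 1 + x $ 2 *\<^sub>R axis 2 1 + x $ 3 *\<^sub>R axis 3 1)" by simp
    then show ?thesis by (simp add: w_add w_scale A_def sum_3)
  qed
  have cube: "A k $ i ^ 3 = A k $ i" for k i
  proof -
    have "biv (axis k 1) ** biv (axis k 1) ** biv (axis k 1) = - biv (axis k 1 :: real^3)"
      unfolding biv_cube_eq_uminus_iff by (simp add: axis_def)
    then have "act g (biv (axis k 1) ** biv (axis k 1) ** biv (axis k 1)) = act g (- biv (axis k 1))" by simp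
    moreover have "act g (- biv (axis k 1)) = - act g (biv (axis k 1))"
      using act_scaleR[of g "-1"] by simp
    ultimately have "biv (A k) ** biv (A k) ** biv (A k) = - biv (A k)"
      by (simp add: act_mult[OF g] w A_def)
    then show ?thesis by (simp only: biv_cube_eq_uminus_iff)
  qed
  have vals: "A k $ i = 0 \<or> A k $ i = 1 \<or> A k $ i = - 1" for k i
  proof -
    have "A k $ i * (A k $ i - 1) * (A k $ i + 1) = 0"
      using cube[of k i] by (simp add: power3_eq_cube algebra_simps)
    then show ?thesis by (auto simp: add_eq_0_iff)
  qed
  have disjoint: "A k $ i * A l $ i = 0" if "k \<noteq> l" for k l i
  proof -
    have "biv (axis k 1) ** biv (axis l 1 :: real^3) = 0"
      unfolding biv_mult_eq_0_iff using that by (simp add: axis_def)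
    then have "act g (biv (axis k 1) ** biv (axis l 1)) = 0" by (simp add: act_def)
    then have "biv (A k) ** biv (A l) = 0" by (simp add: act_mult[OF g] w A_def)
    then show ?thesis by (simp only: biv_mult_eq_0_iff)
  qed
  have "\<exists>i. A k $ i \<noteq> 0" for k
  proof (rule ccontr)
    assume "\<not> (\<exists>i. A k $ i \<noteq> 0)"
    then have "A k = 0" by (simp add: Finite_Cartesian_Product.vec_eq_iff)
    moreover have "w 0 = 0" using w_scale[of 0 0] by simp
    ultimately have "act g (biv (axis k 1)) = act g (biv 0)" by (simp add: w A_def)
    then have "axis k 1 = (0 :: real^3)" by (simp add: act_inj[OF g] biv_inj)
    then show False by (simp add: axis_eq_0_iff)
  qed
  then obtain f where f: "\<And>k. A k $ f k \<noteq> 0" by metis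
  have "inj f"
  proof (rule injI, rule ccontr)
    fix k l assume "f k = f l" "k \<noteq> l"
    then show False using disjoint[of k l "f k"] f[of k] f[of l] by simp
  qed
  then have "surj f" by (intro finite_UNIV_inj_surj finite)
  (* The coordinate i of w x is, up to sign, the coordinate \<kappa> i of x. *)
  define \<kappa> where "\<kappa> i = inv_into UNIV f i" for i
  have \<kappa>: "A (\<kappa> i) $ i \<noteq> 0" for i
    using f[of "\<kappa> i"] \<open>surj f\<close> by (simp add: \<kappa>_def surj_f_inv_f)
  have \<kappa>0: "A k $ i = 0" if "k \<noteq> \<kappa> i" for k i
    using disjoint[OF that, of i] \<kappa>[of i] by simp
  have inj_\<kappa>: "\<kappa> i = \<kappa> j \<longleftrightarrow> i = j" for i j
    using \<open>surj f\<close> by (metis \<kappa>_def surj_f_inv_f)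
  have w_coord: "w x $ i = A (\<kappa> i) $ i * x $ \<kappa> i" for x i
  proof -
    have "w x $ i = (\<Sum>k\<in>UNIV. if k = \<kappa> i then A (\<kappa> i) $ i * x $ \<kappa> i else 0)"
      unfolding w_expand by (intro sum.cong) (auto simp: \<kappa>0)
    then show ?thesis by simp
  qed
  define rank :: "3 \<Rightarrow> int" where "rank k = (if k = 1 then 3 else if k = 2 then 2 else 1)" for k
  have rank_vals: "rank k \<in> {1, 2, 3}" and rank_inj: "rank k = rank l \<longleftrightarrow> k = l" for k l
    using exhaust_3[of k] exhaust_3[of l] by (auto simp: rank_def)
  (* These are the entries of w (3,2,1), the code of w. *)
  define v where "v i = (if A (\<kappa> i) $ i = 1 then rank (\<kappa> i) else - rank (\<kappa> i))" for i
  have v_abs: "\<bar>v i\<bar> = rank (\<kappa> i)" for i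
    using rank_vals[of "\<kappa> i"] by (auto simp: v_def)
  have "w x $ i = entry (v i) x" for x i
    using vals[of "\<kappa> i" i] \<kappa>[of i] exhaust_3[of "\<kappa> i"]
    by (auto simp: w_coord entry_def v_def rank_def)
  then have "w x = signed_perm (v 1, v 2, v 3) x" for x
    by (intro vec3_eqI) simp_all
  moreover have "signed_perm_code (v 1, v 2, v 3)"
  proof -
    have "rank (\<kappa> 1) \<noteq> rank (\<kappa> 2)" "rank (\<kappa> 1) \<noteq> rank (\<kappa> 3)" "rank (\<kappa> 2) \<noteq> rank (\<kappa> 3)"
      by (simp_all add: rank_inj inj_\<kappa>)
    then show ?thesis
      using rank_vals[of "\<kappa> 1"] rank_vals[of "\<kappa> 2"] rank_vals[of "\<kappa> 3"]
      unfolding signed_perm_code_def by (auto simp: v_abs)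
  qed
  ultimately show ?thesis by blast
qed

lemma weyl_codes_iff: "(a, b, c) \<in> set weyl_codes \<longleftrightarrow> signed_perm_code (a, b, c) \<and> a * b * c > 0"
proof
  assume "(a, b, c) \<in> set weyl_codes"
  moreover have "list_all (\<lambda>p. (case p of (a, b, c) \<Rightarrow>
      {\<bar>a\<bar>, \<bar>b\<bar>, \<bar>c\<bar>} = {1, 2, 3} \<and> a * b * c > 0)) weyl_codes"
    by code_simp
  ultimately show "signed_perm_code (a, b, c) \<and> a * b * c > 0"
    by (auto simp: list_all_iff signed_perm_code_def)
next
  assume *: "signed_perm_code (a, b, c) \<and> a * b * c > 0"
  then have eq: "{\<bar>a\<bar>, \<bar>b\<bar>, \<bar>c\<bar>} = {1, 2, 3}" by (simp add: signed_perm_code_def)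
  have val: "v \<in> set [-3, -2, -1, 1, 2, 3]" if "\<bar>v\<bar> \<in> {1, 2, 3}" for v :: int
    using that by auto
  have "card {\<bar>a\<bar>, \<bar>b\<bar>, \<bar>c\<bar>} = 3" unfolding eq by simp
  then have "\<bar>a\<bar> \<noteq> \<bar>b\<bar> \<and> \<bar>a\<bar> \<noteq> \<bar>c\<bar> \<and> \<bar>b\<bar> \<noteq> \<bar>c\<bar>"
    by (auto simp: card_insert_if split: if_splits)
  moreover have "a \<in> set [-3, -2, -1, 1, 2, 3]" "b \<in> set [-3, -2, -1, 1, 2, 3]" "c \<in> set [-3, -2, -1, 1, 2, 3]"
    by (rule val; use eq in blast)+
  ultimately show "(a, b, c) \<in> set weyl_codes"
    using * unfolding weyl_codes_def set_filter set_product by blast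
qed

text \<open>
If the number of sign changes is odd, changing the sign of the third coordinate makes it even.  The
composite is realised by \<open>g ** flip6\<close>, of determinant \<open>- 1\<close>, and also by some \<open>h \<in> SO6\<close>.  The
quotient of the two fixes \<open>biv (1,1,1)\<close>, so its determinant would be 1.
\<close>

lemma SO6_normalizer_even:
  assumes g: "g \<in> SO6" and w: "\<And>x. act g (biv x) = biv (signed_perm p x)" and p: "signed_perm_code p"
  shows "p \<in> set weyl_codes"
proof (rule ccontr)
  assume neg: "p \<notin> set weyl_codes"
  obtain a b c where abc: "p = (a, b, c)" by (cases p)
  define flip :: "int \<Rightarrow> int" where "flip v = (if \<bar>v\<bar> = 1 then - v else v)" for v
  define p' where "p' = (flip a, flip b, flip c)"
  have vals: "\<bar>a\<bar> \<in> {1, 2, 3}" "\<bar>b\<bar> \<in> {1, 2, 3}" "\<bar>c\<bar> \<in> {1, 2, 3}"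
    and dist: "card {\<bar>a\<bar>, \<bar>b\<bar>, \<bar>c\<bar>} = 3" and one: "1 \<in> {\<bar>a\<bar>, \<bar>b\<bar>, \<bar>c\<bar>}"
    using p by (auto simp: signed_perm_code_def abc)
  have ne: "\<bar>a\<bar> \<noteq> \<bar>b\<bar>" "\<bar>a\<bar> \<noteq> \<bar>c\<bar>" "\<bar>b\<bar> \<noteq> \<bar>c\<bar>"
    using dist by (auto simp: card_insert_if split: if_splits)
  have abs_flip: "\<bar>flip v\<bar> = \<bar>v\<bar>" for v by (simp add: flip_def)
  have "flip a * flip b * flip c = - (a * b * c)"
    using one ne by (auto simp: flip_def)
  moreover have "a * b * c < 0"
  proof -
    have "a * b * c \<noteq> 0" using vals by auto
    moreover have "\<not> a * b * c > 0" using neg p by (simp only: abc weyl_codes_iff) simp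
    ultimately show ?thesis by linarith
  qed
  ultimately have p': "p' \<in> set weyl_codes"
    using p by (simp add: p'_def weyl_codes_iff signed_perm_code_def abs_flip abc)
  have entry_flip: "entry (flip v) x = entry v (vector [x $ 1, x $ 2, - x $ 3])" if "\<bar>v\<bar> \<in> {1, 2, 3}" for v x
    using that by (auto simp: entry_def flip_def sgn_if)
  have "act (g ** flip6) (biv x) = biv (signed_perm p' x)" for x
    using vals by (simp add: act_flip6 w abc p'_def entry_flip flip: act_compose)
  moreover obtain h where h: "h \<in> SO6" "\<And>x. act h (biv x) = biv (signed_perm p' x)"
    using signed_perm_in_weyl[OF p'] by (auto simp: weyl_def)
  ultimately have "act (transpose h ** (g ** flip6)) (biv x) = act (transpose h ** h) (biv x)" for x
    by (simp flip: act_compose)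
  moreover have oh: "orthogonal_matrix h" "det h = 1" and og: "orthogonal_matrix g" "det g = 1"
    using h g by (auto simp: SO6_def rotation_matrix_def)
  ultimately have fixes_all: "act (transpose h ** (g ** flip6)) (biv x) = biv x" for x
    by (simp add: orthogonal_matrix_def act_id)
  have "orthogonal_matrix (transpose h ** (g ** flip6))"
    using oh og flip6_orthogonal by (intro orthogonal_matrix_mul) (auto simp: orthogonal_matrix_def)
  then have "det (transpose h ** (g ** flip6)) = 1"
    using det_commuting_biv_ones act_fixes_iff_commute fixes_all by blast
  then show False
    using oh og by (simp add: det_mul Determinants.det_transpose det_flip6)
qed

lemma weyl_SO6: "weyl SO6 = signed_perm ` set weyl_codes"
proof
  show "weyl SO6 \<subseteq> signed_perm ` set weyl_codes"
  proof
    fix w assume "w \<in> weyl SO6"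
    then obtain g where g: "g \<in> SO6" "\<And>x. act g (biv x) = biv (w x)" by (auto simp: weyl_def)
    then obtain p where p: "signed_perm_code p" "w = signed_perm p"
      using normalizer_signed_perm[OF SO6_orthogonal] by blast
    then have "p \<in> set weyl_codes" using SO6_normalizer_even[OF g(1), of p] g(2) by simp
    with p(2) show "w \<in> signed_perm ` set weyl_codes" by blast
  qed
  show "signed_perm ` set weyl_codes \<subseteq> weyl SO6" using signed_perm_in_weyl by blast
qed

lemma weyl_isotropy: "weyl (isotropy (biv l)) = {w \<in> weyl SO6. w l = l}"
proof -
  have "act g (biv l) = biv l \<longleftrightarrow> w l = l" if "\<And>x. act g (biv x) = biv (w x)" for g w
    by (simp add: that biv_inj)
  then show ?thesis unfolding weyl_def isotropy_def by blast
qed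

text \<open>
The composite lies in the Weyl group and so has a code, which evaluation at \<open>(3,2,1)\<close> identifies.
\<close>

lemma code_comp_in_weyl_codes:
  assumes "p \<in> set weyl_codes" "q \<in> set weyl_codes"
  shows "code_comp p q \<in> set weyl_codes" and "signed_perm (code_comp p q) = signed_perm p \<circ> signed_perm q"
proof -
  have "signed_perm p \<circ> signed_perm q \<in> signed_perm ` set weyl_codes"
    using comp_in_weyl signed_perm_in_weyl assms unfolding weyl_SO6 by blast
  then obtain r where r: "r \<in> set weyl_codes" "signed_perm p \<circ> signed_perm q = signed_perm r" by blast
  have "code_vec r = signed_perm r (code_vec (3, 2, 1))" by (simp only: signed_perm_code_vec weyl_codes_base[OF r(1)])
  also have "\<dots> = code_vec (code_comp p q)"
    by (simp only: r(2)[symmetric] o_apply signed_perm_code_vec weyl_codes_base[OF assms(2)])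
  finally have "code_comp p q = r" by (simp only: code_vec_inj)
  with r show "code_comp p q \<in> set weyl_codes" "signed_perm (code_comp p q) = signed_perm p \<circ> signed_perm q" by auto
qed

section \<open>Bruhat polynomials\<close>

text \<open>
The stabiliser is bound by \<open>let\<close> so that it is computed only once.
\<close>

definition minimal_codes :: "code \<Rightarrow> code list" where
  "minimal_codes t = (let S = filter (\<lambda>q. code_comp q t = t) weyl_codes
     in filter (\<lambda>p. list_all (\<lambda>q. inversions p \<le> inversions (code_comp p q)) S) weyl_codes)"

lemma distinct_weyl_codes: "distinct weyl_codes"
  by code_simp

lemma minimal_reps_isotropy: "minimal_reps (isotropy (biv (code_vec t))) = signed_perm ` set (minimal_codes t)"
proof -
  have stab: "weyl (isotropy (biv (code_vec t))) = signed_perm ` {q \<in> set weyl_codes. code_comp q t = t}"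
  proof -
    have "signed_perm q (code_vec t) = code_vec t \<longleftrightarrow> code_comp q t = t" for q
      by (simp only: signed_perm_code_vec code_vec_inj)
    then show ?thesis unfolding weyl_isotropy weyl_SO6 by blast
  qed
  have "signed_perm p \<in> minimal_reps (isotropy (biv (code_vec t))) \<longleftrightarrow> p \<in> set (minimal_codes t)" if "p \<in> set weyl_codes" for p
  proof -
    have "weyl_length (signed_perm p) \<le> weyl_length (signed_perm p \<circ> signed_perm q) \<longleftrightarrow> inversions p \<le> inversions (code_comp p q)"
      if "q \<in> set weyl_codes" for q
      using \<open>p \<in> set weyl_codes\<close> that by (simp add: weyl_length_signed_perm code_comp_in_weyl_codes flip: code_comp_in_weyl_codes(2))
    then show ?thesis
      using that unfolding minimal_reps_def stab weyl_SO6 minimal_codes_def Let_def set_filter list_all_iff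
      by blast
  qed
  moreover have "minimal_reps (isotropy (biv (code_vec t))) \<subseteq> signed_perm ` set weyl_codes"
    unfolding minimal_reps_def weyl_SO6 by blast
  moreover have "set (minimal_codes t) \<subseteq> set weyl_codes"
    unfolding minimal_codes_def Let_def by simp
  ultimately show ?thesis by blast
qed

lemma bruhat_poly_isotropy:
  "bruhat_poly (isotropy (biv (code_vec t))) = (\<Sum>n\<leftarrow>map inversions (minimal_codes t). monom 1 (2 * n))"
proof -
  have sub: "set (minimal_codes t) \<subseteq> set weyl_codes" and dist: "distinct (minimal_codes t)"
    unfolding minimal_codes_def Let_def using distinct_weyl_codes by simp_all
  have "bruhat_poly (isotropy (biv (code_vec t))) = (\<Sum>p\<in>set (minimal_codes t). monom 1 (2 * weyl_length (signed_perm p)))"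
    unfolding bruhat_poly_def minimal_reps_isotropy
    by (subst sum.reindex) (use sub signed_perm_inj in \<open>auto simp: inj_on_def subset_iff\<close>)
  also have "\<dots> = (\<Sum>p\<in>set (minimal_codes t). monom 1 (2 * inversions p))"
    by (intro sum.cong) (use sub weyl_length_signed_perm in auto)
  also have "\<dots> = (\<Sum>n\<leftarrow>map inversions (minimal_codes t). monom 1 (2 * n))"
    using dist by (simp add: sum_list_distinct_conv_sum_set o_def)
  finally show ?thesis .
qed

text \<open>
The points are \<open>(3,2,0)\<close> in the interior of the chamber, one on each edge, and the three vertices.
The entries are listed in the order of \<open>weyl_codes\<close>.
\<close>

lemma minimal_code_lengths:
  "map inversions (minimal_codes (3, 2, 0)) = [6, 5, 5, 4, 5, 4, 4, 3, 4, 3, 3, 2, 4, 3, 3, 2, 3, 2, 2, 1, 2, 1, 1, 0]"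
  "map inversions (minimal_codes (2, 2, 0)) = [5, 4, 4, 3, 3, 2, 3, 2, 2, 1, 1, 0]"
  "map inversions (minimal_codes (2, 1, 1)) = [5, 4, 4, 3, 3, 2, 3, 2, 2, 1, 1, 0]"
  "map inversions (minimal_codes (2, 1, -1)) = [5, 4, 4, 3, 3, 2, 3, 2, 2, 1, 1, 0]"
  "map inversions (minimal_codes (1, 1, 1)) = [3, 2, 1, 0]"
  "map inversions (minimal_codes (1, 1, -1)) = [3, 2, 1, 0]"
  "map inversions (minimal_codes (1, 0, 0)) = [4, 3, 2, 2, 1, 0]"
  by code_simp+

lemma monom_even_power: "monom 1 (2 * n) = ([:0, 1:] ^ 2) ^ n" for n :: nat
  by (simp add: monom_altdef flip: power_mult)

lemma bruhat_polys:
  fixes q :: "int poly" defines "q \<equiv> [:0, 1:] ^ 2"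
  defines "F \<equiv> (1 + q) * (1 + q + q ^ 2) * (1 + q + q ^ 2 + q ^ 3)"
    and "E \<equiv> (1 + q + q ^ 2) * (1 + q + q ^ 2 + q ^ 3)" and "Q \<equiv> 1 + q + q ^ 2 + q ^ 3"
    and "R \<equiv> 1 + q + 2 * q ^ 2 + q ^ 3 + q ^ 4"
  shows "bruhat_poly (isotropy (biv (vector [3, 2, 0]))) = F"
    and "bruhat_poly (isotropy (biv (vector [2, 2, 0]))) = E"
    and "bruhat_poly (isotropy (biv (vector [2, 1, 1]))) = E"
    and "bruhat_poly (isotropy (biv (vector [2, 1, - 1]))) = E"
    and "bruhat_poly (isotropy (biv (vector [1, 1, 1]))) = Q"
    and "bruhat_poly (isotropy (biv (vector [1, 1, - 1]))) = Q"
    and "bruhat_poly (isotropy (biv (vector [1, 0, 0]))) = R"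
proof -
  have eval: "bruhat_poly (isotropy (biv (code_vec t))) = (\<Sum>n\<leftarrow>ns. q ^ n)"
    if "map inversions (minimal_codes t) = ns" for t ns
    unfolding bruhat_poly_isotropy that monom_even_power q_def ..
  note ev = minimal_code_lengths[THEN eval]
  note pw = algebra_simps eval_nat_numeral
  show "bruhat_poly (isotropy (biv (vector [3, 2, 0]))) = F"
    using ev(1) by (simp add: F_def pw)
  show "bruhat_poly (isotropy (biv (vector [2, 2, 0]))) = E"
    using ev(2) by (simp add: E_def pw)
  show "bruhat_poly (isotropy (biv (vector [2, 1, 1]))) = E"
    using ev(3) by (simp add: E_def pw)
  show "bruhat_poly (isotropy (biv (vector [2, 1, - 1]))) = E"
    using ev(4) by (simp add: E_def pw)
  show "bruhat_poly (isotropy (biv (vector [1, 1, 1]))) = Q"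
    using ev(5) by (simp add: Q_def pw)
  show "bruhat_poly (isotropy (biv (vector [1, 1, - 1]))) = Q"
    using ev(6) by (simp add: Q_def pw)
  show "bruhat_poly (isotropy (biv (vector [1, 0, 0]))) = R"
    using ev(7) by (simp add: R_def pw)
qed

section \<open>The faces of the orbit triangle\<close>

text \<open>
The extreme rays of the chamber, scaled to have integer entries.
\<close>

definition fundamental_weight :: "real^3 \<Rightarrow> real^3" where
  "fundamental_weight \<alpha> = (if \<alpha> = vector [1, - 1, 0] then vector [1, 0, 0]
     else if \<alpha> = vector [0, 1, - 1] then vector [1, 1, - 1] else vector [1, 1, 1])"

lemma simple_roots_distinct:
  "(vector [1, - 1, 0] :: real^3) \<noteq> vector [0, 1, - 1]" "(vector [1, - 1, 0] :: real^3) \<noteq> vector [0, 1, 1]"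
  "(vector [0, 1, - 1] :: real^3) \<noteq> vector [0, 1, 1]"
  by (auto simp: Finite_Cartesian_Product.vec_eq_iff forall_3)

lemma fundamental_weight_simps:
  "fundamental_weight (vector [1, - 1, 0]) = vector [1, 0, 0]"
  "fundamental_weight (vector [0, 1, - 1]) = vector [1, 1, - 1]"
  "fundamental_weight (vector [0, 1, 1]) = vector [1, 1, 1]"
  using simple_roots_distinct by (simp_all add: fundamental_weight_def)

lemma finite_simple_roots: "finite simple_roots" and card_simple_roots: "card simple_roots = 3"
  using simple_roots_distinct by (simp_all add: simple_roots_def)

lemma ball_simple_roots:
  "(\<forall>\<alpha>\<in>simple_roots. P \<alpha>) \<longleftrightarrow>
     P (vector [1, - 1, 0]) \<and> P (vector [0, 1, - 1]) \<and> P (vector [0, 1, 1])"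
  by (simp add: simple_roots_def)

lemma sum_simple_roots:
  "(\<Sum>\<alpha>\<in>simple_roots. f \<alpha>) = f (vector [1, - 1, 0]) + f (vector [0, 1, - 1]) + f (vector [0, 1, 1])"
  using simple_roots_distinct by (simp add: simple_roots_def add.assoc)

lemma fundamental_weight_dual:
  assumes "\<alpha> \<in> simple_roots" "\<beta> \<in> simple_roots" "\<alpha> \<noteq> \<beta>"
  shows "fundamental_weight \<alpha> \<bullet> \<beta> = 0"
proof -
  have "\<forall>\<alpha>\<in>simple_roots. \<forall>\<beta>\<in>simple_roots. \<alpha> \<noteq> \<beta> \<longrightarrow> fundamental_weight \<alpha> \<bullet> \<beta> = 0"
    unfolding ball_simple_roots fundamental_weight_simps inner_simple_roots by simp
  then show ?thesis using assms by blast
qed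

lemma fundamental_weight_pos:
  assumes "\<alpha> \<in> simple_roots" shows "fundamental_weight \<alpha> \<bullet> \<alpha> > 0"
proof -
  have "\<forall>\<alpha>\<in>simple_roots. fundamental_weight \<alpha> \<bullet> \<alpha> > 0"
    unfolding ball_simple_roots fundamental_weight_simps inner_simple_roots by simp
  then show ?thesis using assms by blast
qed

lemma fundamental_weight_expansion:
  "l = (\<Sum>\<alpha>\<in>simple_roots. (l \<bullet> \<alpha> / (fundamental_weight \<alpha> \<bullet> \<alpha>)) *\<^sub>R fundamental_weight \<alpha>)"
  unfolding sum_simple_roots fundamental_weight_simps inner_simple_roots
  by (rule vec3_eqI) (simp_all add: field_simps)

lemma in_chamber_iff: "in_chamber l \<longleftrightarrow> (\<forall>\<alpha>\<in>simple_roots. 0 \<le> l \<bullet> \<alpha>)"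
  unfolding ball_simple_roots inner_simple_roots in_chamber_def by linarith

definition cone_face :: "(real^3) set \<Rightarrow> (real^3) set" where
  "cone_face I = {l. in_chamber l \<and> (\<forall>\<alpha>\<in>simple_roots. l \<bullet> \<alpha> = 0 \<longleftrightarrow> \<alpha> \<in> I)}"

definition open_face :: "(real^3) set \<Rightarrow> (real^3) set" where
  "open_face I = {l \<in> orbit_triangle. \<forall>\<alpha>\<in>simple_roots. l \<bullet> \<alpha> = 0 \<longleftrightarrow> \<alpha> \<in> I}"

lemma open_face_cone: "open_face I = {l \<in> cone_face I. norm l = 1}"
  by (auto simp: open_face_def cone_face_def orbit_triangle_def in_chamber_def)

text \<open>
An integral point in the open face of the chamber on which exactly the roots in \<open>I\<close> vanish.
\<close>

definition barycenter :: "(real^3) set \<Rightarrow> real^3" where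
  "barycenter I = (\<Sum>\<alpha>\<in>simple_roots - I. fundamental_weight \<alpha>)"

lemma barycenter_inner:
  assumes "\<beta> \<in> simple_roots"
  shows "barycenter I \<bullet> \<beta> = (if \<beta> \<in> I then 0 else fundamental_weight \<beta> \<bullet> \<beta>)"
proof -
  have "barycenter I \<bullet> \<beta> = (\<Sum>\<alpha>\<in>simple_roots - I. if \<alpha> = \<beta> then fundamental_weight \<beta> \<bullet> \<beta> else 0)"
    unfolding barycenter_def inner_sum_left
    by (intro sum.cong) (use assms fundamental_weight_dual in auto)
  then show ?thesis using assms finite_simple_roots by simp
qed

lemma barycenter_in_cone_face: "barycenter I \<in> cone_face I"
proof -
  have "0 \<le> barycenter I \<bullet> \<alpha> \<and> (barycenter I \<bullet> \<alpha> = 0 \<longleftrightarrow> \<alpha> \<in> I)" if "\<alpha> \<in> simple_roots" for \<alpha>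
    using fundamental_weight_pos[OF that] by (simp add: barycenter_inner that)
  then show ?thesis by (simp add: cone_face_def in_chamber_iff)
qed

lemma normalized_in_open_face:
  assumes "l \<in> cone_face I" and "l \<noteq> 0" shows "(1 / norm l) *\<^sub>R l \<in> open_face I"
  using assms by (auto simp: open_face_cone cone_face_def in_chamber_iff)

text \<open>
On the face, the coefficients of the weights of roots in \<open>I\<close> vanish.  Conversely a weight outside
\<open>I\<close> is the difference of two points of the open cone, namely of the barycenter shifted by that
weight and the barycenter.
\<close>

lemma span_open_face:
  "span (open_face I) = span (fundamental_weight ` (simple_roots - I))"
  unfolding span_eq
proof
  show "open_face I \<subseteq> span (fundamental_weight ` (simple_roots - I))"
  proof
    fix l assume l: "l \<in> open_face I"
    have "(l \<bullet> \<alpha> / (fundamental_weight \<alpha> \<bullet> \<alpha>)) *\<^sub>R fundamental_weight \<alpha>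
        \<in> span (fundamental_weight ` (simple_roots - I))" if "\<alpha> \<in> simple_roots" for \<alpha>
    proof (cases "\<alpha> \<in> I")
      case True
      then have "l \<bullet> \<alpha> = 0" using l that by (auto simp: open_face_def)
      then show ?thesis by (simp add: span_zero)
    next
      case False
      then show ?thesis using that by (intro span_scale span_base) blast
    qed
    then show "l \<in> span (fundamental_weight ` (simple_roots - I))"
      by (subst fundamental_weight_expansion) (rule span_sum)
  qed
  have cone: "l \<in> span (open_face I)" if "l \<in> cone_face I" for l
  proof (cases "l = 0")
    case False
    then have "norm l *\<^sub>R (1 / norm l) *\<^sub>R l \<in> span (open_face I)"
      using normalized_in_open_face[OF that] by (intro span_scale span_base)
    with False show ?thesis by simp
  qed (simp add: span_zero)
  show "fundamental_weight ` (simple_roots - I) \<subseteq> span (open_face I)"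
  proof
    fix w assume "w \<in> fundamental_weight ` (simple_roots - I)"
    then obtain \<beta> where \<beta>: "\<beta> \<in> simple_roots" "\<beta> \<notin> I" and w: "w = fundamental_weight \<beta>" by blast
    have "(barycenter I + w) \<bullet> \<alpha> = barycenter I \<bullet> \<alpha> \<or> \<alpha> = \<beta> \<and> (barycenter I + w) \<bullet> \<alpha> > 0"
      if "\<alpha> \<in> simple_roots" for \<alpha>
      using that \<beta> fundamental_weight_dual[OF \<beta>(1) that] fundamental_weight_pos[OF \<beta>(1)]
      by (cases "\<alpha> = \<beta>") (auto simp: w inner_add_left barycenter_inner)
    then have "barycenter I + w \<in> cone_face I"
      using barycenter_in_cone_face[of I] \<beta> unfolding cone_face_def in_chamber_iff
      by (smt (verit) mem_Collect_eq)
    then have "(barycenter I + w) - barycenter I \<in> span (open_face I)"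
      by (intro span_diff cone barycenter_in_cone_face)
    then show "w \<in> span (open_face I)" by simp
  qed
qed

lemma inj_fundamental_weight: "inj_on fundamental_weight simple_roots"
proof (rule inj_onI, rule ccontr)
  fix \<alpha> \<beta> assume *: "\<alpha> \<in> simple_roots" "\<beta> \<in> simple_roots" "fundamental_weight \<alpha> = fundamental_weight \<beta>" "\<alpha> \<noteq> \<beta>"
  show False
    using fundamental_weight_dual[OF *(2,1)] fundamental_weight_pos[OF *(1)] * by simp
qed

lemma independent_fundamental_weights: "independent (fundamental_weight ` simple_roots)"
proof (rule card_le_dim_spanning)
  show "UNIV \<subseteq> span (fundamental_weight ` simple_roots)"
  proof
    fix l :: "real^3"
    show "l \<in> span (fundamental_weight ` simple_roots)"
      by (subst fundamental_weight_expansion) (intro span_sum span_scale span_base imageI)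
  qed
  show "card (fundamental_weight ` simple_roots) \<le> dim (UNIV :: (real^3) set)"
    by (simp add: card_image[OF inj_fundamental_weight] card_simple_roots)
qed (use finite_simple_roots in auto)

lemma face_dim_open_face:
  assumes "I \<subseteq> simple_roots" shows "face_dim (open_face I) = 2 - card I"
proof -
  have "independent (fundamental_weight ` (simple_roots - I))"
    by (rule independent_mono[OF independent_fundamental_weights]) blast
  then have "dim (fundamental_weight ` (simple_roots - I)) = card (fundamental_weight ` (simple_roots - I))"
    by (rule dim_eq_card_independent)
  also have "\<dots> = 3 - card I"
    using assms finite_simple_roots inj_fundamental_weight
    by (subst card_image) (auto intro: inj_on_subset simp: card_Diff_subset finite_subset card_simple_roots)
  finally have "dim (open_face I) = 3 - card I"
    by (metis dim_span span_open_face)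
  then show ?thesis by (simp add: face_dim_def)
qed

lemma open_face_nonempty:
  assumes "I \<subset> simple_roots" shows "open_face I \<noteq> {}"
proof -
  obtain \<alpha> where \<alpha>: "\<alpha> \<in> simple_roots" "\<alpha> \<notin> I" using assms by blast
  then have "barycenter I \<bullet> \<alpha> \<noteq> 0"
    using fundamental_weight_pos[OF \<alpha>(1)] by (simp add: barycenter_inner)
  then have "barycenter I \<noteq> 0" by auto
  then show ?thesis using normalized_in_open_face[OF barycenter_in_cone_face] by blast
qed

lemma open_face_all: "open_face simple_roots = {}"
proof -
  have "l = 0" if "\<forall>\<alpha>\<in>simple_roots. l \<bullet> \<alpha> = 0" for l
    by (subst fundamental_weight_expansion) (simp add: that)
  then show ?thesis by (fastforce simp: open_face_cone cone_face_def)
qed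

lemma face_isotropy_open_face:
  assumes "I \<subset> simple_roots"
  shows "face_isotropy (open_face I) = isotropy (biv (barycenter I))"
proof -
  have eq: "isotropy (biv l) = isotropy (biv (barycenter I))" if "l \<in> open_face I" for l
    using that barycenter_in_cone_face[of I]
    by (intro isotropy_biv_eq) (auto simp: open_face_cone cone_face_def)
  obtain l where "l \<in> open_face I" using open_face_nonempty[OF assms] by blast
  then show ?thesis
    unfolding face_isotropy_def using eq by (intro the_equality) blast+
qed

lemma open_faces_eq: "open_faces = open_face ` (Pow simple_roots - {simple_roots})"
proof -
  have "open_faces = open_face ` Pow simple_roots - {{}}"
    unfolding open_faces_def open_face_def by blast
  moreover have "open_face ` Pow simple_roots = insert {} (open_face ` (Pow simple_roots - {simple_roots}))"
    using open_face_all by (metis Pow_top image_insert insert_Diff)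
  moreover have "{} \<notin> open_face ` (Pow simple_roots - {simple_roots})"
  proof
    assume "{} \<in> open_face ` (Pow simple_roots - {simple_roots})"
    then obtain I where "I \<in> Pow simple_roots - {simple_roots}" "{} = open_face I" by (rule imageE)
    then have "I \<subset> simple_roots" "open_face I = {}" by auto
    then show False using open_face_nonempty by simp
  qed
  ultimately show ?thesis by simp
qed

lemma inj_open_face: "inj_on open_face (Pow simple_roots - {simple_roots})"
proof (rule inj_onI)
  fix I K assume I: "I \<in> Pow simple_roots - {simple_roots}" and K: "K \<in> Pow simple_roots - {simple_roots}"
    and eq: "open_face I = open_face K"
  then obtain l where "l \<in> open_face I" "l \<in> open_face K" using open_face_nonempty[of I] by blast
  then have "\<alpha> \<in> I \<longleftrightarrow> \<alpha> \<in> K" if "\<alpha> \<in> simple_roots" for \<alpha>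
    using that by (simp add: open_face_def)
  then show "I = K" using I K by blast
qed

lemma face_inventory_sum:
  "face_inventory = (\<Sum>I\<in>Pow simple_roots - {simple_roots}.
     monom 1 (2 - card I) * bruhat_poly (isotropy (biv (barycenter I))))"
  unfolding face_inventory_def open_faces_eq sum.reindex[OF inj_open_face] o_def
proof (rule sum.cong[OF refl])
  fix I assume "I \<in> Pow simple_roots - {simple_roots}"
  then have "I \<subset> simple_roots" by auto
  then show "monom 1 (face_dim (open_face I)) * bruhat_poly (face_isotropy (open_face I)) =
      monom 1 (2 - card I) * bruhat_poly (isotropy (biv (barycenter I)))"
    by (simp add: face_dim_open_face face_isotropy_open_face psubset_imp_subset)
qed

text \<open>
With the simple roots for \<open>a, b, c\<close>, the terms belong to the interior, the three edges and the
three vertices.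
\<close>

lemma sum_proper_subsets_3:
  assumes "a \<noteq> b" "a \<noteq> c" "b \<noteq> c"
  shows "(\<Sum>I\<in>Pow {a, b, c} - {{a, b, c}}. f I) =
    f {} + f {a} + f {b} + f {c} + f {a, b} + f {a, c} + (f {b, c} :: 'b::comm_monoid_add)"
proof -
  have "Pow {a, b, c} - {{a, b, c}} = {{}, {a}, {b}, {c}, {a, b}, {a, c}, {b, c}}"
    using assms by (auto simp: Pow_insert)
  moreover have "distinct [{}, {a}, {b}, {c}, {a, b}, {a, c}, {b, c}]"
    using assms by (auto simp: doubleton_eq_iff)
  ultimately have "(\<Sum>I\<in>Pow {a, b, c} - {{a, b, c}}. f I) =
      (\<Sum>I\<leftarrow>[{}, {a}, {b}, {c}, {a, b}, {a, c}, {b, c}]. f I)"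
    by (simp only: sum_list_distinct_conv_sum_set) simp
  then show ?thesis by (simp add: ac_simps)
qed

lemma barycenters:
  "barycenter {} = vector [3, 2, 0]"
  "barycenter {vector [1, - 1, 0]} = vector [2, 2, 0]"
  "barycenter {vector [0, 1, - 1]} = vector [2, 1, 1]"
  "barycenter {vector [0, 1, 1]} = vector [2, 1, - 1]"
  "barycenter {vector [1, - 1, 0], vector [0, 1, - 1]} = vector [1, 1, 1]"
  "barycenter {vector [1, - 1, 0], vector [0, 1, 1]} = vector [1, 1, - 1]"
  "barycenter {vector [0, 1, - 1], vector [0, 1, 1]} = vector [1, 0, 0]"
proof -
  let ?a = "vector [1, - 1, 0] :: real^3" and ?b = "vector [0, 1, - 1] :: real^3" and ?c = "vector [0, 1, 1] :: real^3"
  have bary: "barycenter I = (if ?a \<in> I then 0 else vector [1, 0, 0]) + (if ?b \<in> I then 0 else vector [1, 1, - 1])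
      + (if ?c \<in> I then 0 else vector [1, 1, 1])" for I
  proof -
    have "(\<Sum>\<alpha>\<in>simple_roots. if \<alpha> \<in> I then 0 else fundamental_weight \<alpha>) =
        (\<Sum>\<alpha>\<in>simple_roots - I. if \<alpha> \<in> I then 0 else fundamental_weight \<alpha>)"
      by (intro sum.mono_neutral_right finite_simple_roots) auto
    also have "\<dots> = barycenter I"
      unfolding barycenter_def by (intro sum.cong) auto
    finally have "barycenter I = (\<Sum>\<alpha>\<in>simple_roots. if \<alpha> \<in> I then 0 else fundamental_weight \<alpha>)" ..
    then show ?thesis by (simp only: sum_simple_roots fundamental_weight_simps)
  qed
  note neq = simple_roots_distinct simple_roots_distinct[symmetric]
  show "barycenter {} = vector [3, 2, 0]" "barycenter {?a} = vector [2, 2, 0]" "barycenter {?b} = vector [2, 1, 1]"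
    "barycenter {?c} = vector [2, 1, - 1]" "barycenter {?a, ?b} = vector [1, 1, 1]"
    "barycenter {?a, ?c} = vector [1, 1, - 1]" "barycenter {?b, ?c} = vector [1, 0, 0]"
    unfolding bary by (rule vec3_eqI; simp add: neq)+
qed

section \<open>The face inventory\<close>

lemma face_inventory_eq:
  fixes t q :: "int poly" defines "t \<equiv> [:0, 1:]" and "q \<equiv> t ^ 2"
  shows "face_inventory = t ^ 2 * ((1 + q) * (1 + q + q ^ 2) * (1 + q + q ^ 2 + q ^ 3))
    + 3 * t * ((1 + q + q ^ 2) * (1 + q + q ^ 2 + q ^ 3)) + 2 * (1 + q + q ^ 2 + q ^ 3)
    + (1 + q + 2 * q ^ 2 + q ^ 3 + q ^ 4)"
proof -
  have card2: "card {x, y} = 2" if "x \<noteq> y" for x y :: "real^3" using that by simp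
  have t: "monom 1 0 = (1 :: int poly)" "monom 1 1 = t" "monom 1 2 = t ^ 2"
    by (simp_all add: monom_altdef t_def)
  have ring: "x * f + y * e + y * e + y * e + g + g + r = x * f + 3 * y * e + 2 * g + r"
    for x y f e g r :: "int poly" by (simp add: algebra_simps)
  note cards = card2[OF simple_roots_distinct(1)] card2[OF simple_roots_distinct(2)] card2[OF simple_roots_distinct(3)]
  have "2 - card {x :: real^3} = 1" "2 - card ({} :: (real^3) set) = 2" for x by simp_all
  then have "face_inventory = t ^ 2 * bruhat_poly (isotropy (biv (vector [3, 2, 0])))
    + t * bruhat_poly (isotropy (biv (vector [2, 2, 0]))) + t * bruhat_poly (isotropy (biv (vector [2, 1, 1])))
    + t * bruhat_poly (isotropy (biv (vector [2, 1, - 1]))) + bruhat_poly (isotropy (biv (vector [1, 1, 1])))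
    + bruhat_poly (isotropy (biv (vector [1, 1, - 1]))) + bruhat_poly (isotropy (biv (vector [1, 0, 0])))"
    unfolding face_inventory_sum unfolding simple_roots_def sum_proper_subsets_3[OF simple_roots_distinct]
      barycenters cards by (simp only: t diff_self_eq_0 mult_1)
  then show ?thesis
    unfolding bruhat_polys q_def t_def ring .
qed

lemma inventory_identity:
  "let t = [:0, 1:] :: int poly; q = t ^ 2;
       F = (1 + q) * (1 + q + q ^ 2) * (1 + q + q ^ 2 + q ^ 3);
       E = (1 + q + q ^ 2) * (1 + q + q ^ 2 + q ^ 3);
       Q = 1 + q + q ^ 2 + q ^ 3;
       R = 1 + q + 2 * q ^ 2 + q ^ 3 + q ^ 4;
       B = 2 + t + 3 * t ^ 2 + 3 * t ^ 3 + 4 * t ^ 4 + 5 * t ^ 5 + 3 * t ^ 6 + 6 * t ^ 7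
             + t ^ 8 + 5 * t ^ 9 + 3 * t ^ 11
   in t ^ 2 * F + 3 * t * E + 2 * Q + R = 1 + t ^ 14 + (1 + t) * B \<and>
      B = [:2, 1, 3, 3, 4, 5, 3, 6, 1, 5, 0, 3:]"
  by code_simp

lemma nonneg_coeffs: "0 \<le> coeff [:2, 1, 3, 3, 4, 5, 3, 6, 1, 5, 0, 3 :: int:] i"
  by (simp add: coeff_pCons split: nat.split)

theorem proposition18p2:
  shows
    "let t = [:0, 1:] :: int poly;
         q = t ^ 2;
         F = (1 + q) * (1 + q + q ^ 2) * (1 + q + q ^ 2 + q ^ 3);
         E = (1 + q + q ^ 2) * (1 + q + q ^ 2 + q ^ 3);
         Q = 1 + q + q ^ 2 + q ^ 3;
         R = 1 + q + 2 * q ^ 2 + q ^ 3 + q ^ 4;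
         B = 2 + t + 3 * t ^ 2 + 3 * t ^ 3 + 4 * t ^ 4 + 5 * t ^ 5 + 3 * t ^ 6 + 6 * t ^ 7
               + t ^ 8 + 5 * t ^ 9 + 3 * t ^ 11
     in bruhat_poly T3 = F \<and>
        bruhat_poly U2_SO2 = E \<and>
        bruhat_poly U3 = Q \<and>
        bruhat_poly SO2_SO4 = R \<and>
        face_inventory = t ^ 2 * F + 3 * t * E + 2 * Q + R \<and>
        face_inventory = 1 + t ^ 14 + (1 + t) * B \<and>
        (\<forall>i. 0 \<le> coeff B i) \<and>
        passes_nonneg_test face_inventory (1 + t ^ 14) \<and>
        (\<forall>c (d :: nat \<Rightarrow> 'a::idom mat). finite_free_complex c d \<longrightarrow>
           passes_nonneg_test (cell_count_poly c) (poincare_poly c d))"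
proof -
  define t :: "int poly" where "t = [:0, 1:]"
  define q where "q = t ^ 2"
  define F where "F = (1 + q) * (1 + q + q ^ 2) * (1 + q + q ^ 2 + q ^ 3)"
  define E where "E = (1 + q + q ^ 2) * (1 + q + q ^ 2 + q ^ 3)"
  define Q where "Q = 1 + q + q ^ 2 + q ^ 3"
  define R where "R = 1 + q + 2 * q ^ 2 + q ^ 3 + q ^ 4"
  define B where "B = 2 + t + 3 * t ^ 2 + 3 * t ^ 3 + 4 * t ^ 4 + 5 * t ^ 5 + 3 * t ^ 6 + 6 * t ^ 7
    + t ^ 8 + 5 * t ^ 9 + 3 * t ^ 11"
  note defs = F_def E_def Q_def R_def q_def t_def
  have bruhat: "bruhat_poly T3 = F" "bruhat_poly U2_SO2 = E" "bruhat_poly U3 = Q" "bruhat_poly SO2_SO4 = R"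
    unfolding T3_isotropy U2_SO2_isotropy U3_isotropy SO2_SO4_isotropy bruhat_polys defs by (rule refl)+
  have inventory: "face_inventory = t ^ 2 * F + 3 * t * E + 2 * Q + R"
    unfolding face_inventory_eq defs by (rule refl)
  have "t ^ 2 * F + 3 * t * E + 2 * Q + R = 1 + t ^ 14 + (1 + t) * B"
    and B: "B = [:2, 1, 3, 3, 4, 5, 3, 6, 1, 5, 0, 3:]"
    using inventory_identity unfolding Let_def B_def defs by blast+
  then have identity: "face_inventory = 1 + t ^ 14 + (1 + t) * B"
    using inventory by simp
  have nonneg: "\<forall>i. 0 \<le> coeff B i"
    unfolding B using nonneg_coeffs by blast
  have "face_inventory - (1 + t ^ 14) = (1 + [:0, 1:]) * B"
    by (simp add: identity t_def)
  then have test: "passes_nonneg_test face_inventory (1 + t ^ 14)"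
    unfolding passes_nonneg_test_def using nonneg by blast
  have complexes: "\<forall>c (d :: nat \<Rightarrow> 'a mat). finite_free_complex c d \<longrightarrow>
      passes_nonneg_test (cell_count_poly c) (poincare_poly c d)"
    using finite_free_complex_nonneg_test by blast
  show ?thesis
    using bruhat inventory identity nonneg test complexes
    unfolding Let_def F_def E_def Q_def R_def B_def q_def t_def by blast
qed

end
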